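(* Assume that the weight configuration $(\Lambda_1,\dots,\Lambda_n)$ has uniform maximal rank. Fix a singular support $I$ and the residual dimension $d_I=k-|I|$. The linear-equivalence classes of labelled residual configurations $(\beta_j)_{j\in J}$ of dimension $d_I$ and of uniform maximal rank having the same coordinate-labelled envelope as $(\mu_j)_{j\in J}$ (that is, with resonance semigroup exactly $S_I\subset\mathbb N^J$) are naturally parametrised, in the Euclidean topology, by a dense $G_\delta$ subset of the Grassmannian $$\operatorname{Gr}_{\delta_I}(\mathbb C^J/R_I).$$ This Grassmannian has dimension $\delta_Id_I$. Consequently, the coordinate-labelled envelope determines the residual weight configuration (up to linear equivalence, among labelled residual configurations of dimension $d_I$ and uniform maximal rank) if and only if $\delta_I=0$, equivalently if and only if $\dim Q_I=n-k$. When $\delta_I>0$, uncountably many pairwise non-linearly-equivalent such residual configurations have the same labelled envelope.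
   Context: Let $\mathfrak g=\mathbb C^k$ and let $\Lambda_1,\dots,\Lambda_n\in\mathfrak g^*$ span $\mathfrak g^*$; they are the weights of the diagonal action $t\cdot z=(e^{\Lambda_j(t)}z_j)_j$ on $\mathbb C^n$. For $I\subset\{1,\dots,n\}$ put $J=I^c$, $r_I=\dim\operatorname{Span}\{\Lambda_i:i\in I\}$, $\mathfrak h_I=\bigcap_{i\in I}\ker\Lambda_i$, $\mu_j=\Lambda_j|_{\mathfrak h_I}$ ($j\in J$). $I$ is a singular support if $r_I<k$. The configuration has uniform maximal rank if $r_I=\min\{|I|,k\}$ for every $I$; then singular supports are those with $|I|<k$, and $\dim\mathfrak h_I=k-|I|$. $S_I=\{\alpha\in\mathbb N^J:\sum_{j\in J}\alpha_j\mu_j=0\}$ with $0\in\mathbb N$, $Q_I=\operatorname{Spec}\mathbb C[S_I]$, $M_I=\operatorname{gp}(S_I)\subset\mathbb Z^J$ the group generated by $S_I$, $R_I=M_I\otimes_{\mathbb Z}\mathbb C\subset\mathbb C^J$, and, under uniform maximal rank, $\delta_I=(n-k)-\dim Q_I$ where $\dim Q_I=\operatorname{rk}M_I$. A labelled residual configuration of dimension $d$ is a family $(\beta_j)_{j\in J}$ spanning a $d$-dimensional complex vector space; it has uniform maximal rank if $\dim\operatorname{Span}\{\beta_j:j\in K\}=\min\{|K|,d\}$ for all $K\subset J$. Two such are linearly equivalent if a linear isomorphism carries each labelled weight to the weight with the same label. Its resonance semigroup is $\{\alpha\in\mathbb N^J:\sum_j\alpha_j\beta_j=0\}$; the coordinate-labelled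 envelope is the quotient map $\mathbb C^J\to\operatorname{Spec}\mathbb C[S]$ with the coordinates $w_j$ labelled, which amounts to the datum of the semigroup $S$ as a subset of $\mathbb N^J$. The natural parametrisation sends the class of $(\beta_j)$ to $K/R_I\subset\mathbb C^J/R_I$, where $K=\ker(\mathbb C^J\to\operatorname{Span}\{\beta_j\},\ e_j\mapsto\beta_j)$. *)

theory Defs
  imports "HOL-Analysis.Analysis" "HOL-Library.Function_Algebras"
begin

section \<open>Configurations of covectors\<close>

text \<open>The space \<open>\<gg>\<close> is \<^typ>\<open>complex^'k\<close>, and the labels form a finite type \<open>'n\<close>. Covectors on \<open>\<gg>\<close>, and on
  subspaces of \<open>\<gg>\<close>, live in the complex vector space of all functions on \<open>\<gg>\<close>; a functional on a
  subspace is continued by \<open>0\<close>.\<close>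

definition fscale :: "complex \<Rightarrow> ('a \<Rightarrow> complex) \<Rightarrow> 'a \<Rightarrow> complex" where
  "fscale c f = (\<lambda>x. c * f x)"

lemma vector_space_fscale: "vector_space fscale"
  by unfold_locales (auto simp: fscale_def fun_eq_iff algebra_simps)

interpretation fun_vs: vector_space fscale
  by (rule vector_space_fscale)

definition dual_space :: "(complex^'k \<Rightarrow> complex) set" where
  "dual_space = {f. Vector_Spaces.linear (*s) (*) f}"

definition weight_configuration :: "('n::finite \<Rightarrow> complex^'k \<Rightarrow> complex) \<Rightarrow> bool" where
  "weight_configuration \<Lambda> \<longleftrightarrow> range \<Lambda> \<subseteq> dual_space \<and> fun_vs.span (range \<Lambda>) = dual_space"

definition weight_rank :: "('n::finite \<Rightarrow> complex^'k \<Rightarrow> complex) \<Rightarrow> 'n set \<Rightarrow> nat" where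
  "weight_rank \<beta> K = fun_vs.dim (\<beta> ` K)"

text \<open>A labelled configuration \<open>(\<beta>\<^sub>j)\<close> with \<open>j \<in> J\<close> is given by a function on all labels; its values
  outside \<open>J\<close> play no role below. Since \<open>d \<le> k\<close> in all uses, every complex vector space of
  dimension \<open>d\<close> is isomorphic to a subspace of the ambient space chosen here.\<close>

definition uniform_maximal_rank ::
  "'n::finite set \<Rightarrow> nat \<Rightarrow> ('n \<Rightarrow> complex^'k \<Rightarrow> complex) \<Rightarrow> bool" where
  "uniform_maximal_rank J d \<beta> \<longleftrightarrow> (\<forall>K\<subseteq>J. weight_rank \<beta> K = min (card K) d)"

definition residual_configuration ::
  "'n::finite set \<Rightarrow> nat \<Rightarrow> ('n \<Rightarrow> complex^'k \<Rightarrow> complex) \<Rightarrow> bool" where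
  "residual_configuration J d \<beta> \<longleftrightarrow> weight_rank \<beta> J = d"

text \<open>A linear isomorphism between the two spans always extends to a linear map of the ambient space.\<close>

definition linearly_equivalent ::
  "'n::finite set \<Rightarrow> ('n \<Rightarrow> complex^'k \<Rightarrow> complex) \<Rightarrow> ('n \<Rightarrow> complex^'k \<Rightarrow> complex) \<Rightarrow> bool" where
  "linearly_equivalent J \<beta> \<gamma> \<longleftrightarrow>
     (\<exists>f. Vector_Spaces.linear fscale fscale f \<and>
          bij_betw f (fun_vs.span (\<beta> ` J)) (fun_vs.span (\<gamma> ` J)) \<and>
          (\<forall>j\<in>J. f (\<beta> j) = \<gamma> j))"

text \<open>The subset of \<open>\<nat>\<^sup>J\<close>, where vectors indexed by \<open>J\<close> are vectors on all labels vanishing off \<open>J\<close>.\<close>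

definition resonance_semigroup ::
  "'n::finite set \<Rightarrow> ('n \<Rightarrow> complex^'k \<Rightarrow> complex) \<Rightarrow> (nat^'n) set" where
  "resonance_semigroup J \<beta> =
     {\<alpha>. (\<forall>i. i \<notin> J \<longrightarrow> \<alpha> $ i = 0) \<and> (\<Sum>j\<in>J. fscale (of_nat (\<alpha> $ j)) (\<beta> j)) = 0}"

definition coord_space :: "'n::finite set \<Rightarrow> (complex^'n) set" where
  "coord_space J = {w. \<forall>i. i \<notin> J \<longrightarrow> w $ i = 0}"

definition relation_space ::
  "'n::finite set \<Rightarrow> ('n \<Rightarrow> complex^'k \<Rightarrow> complex) \<Rightarrow> (complex^'n) set" where
  "relation_space J \<beta> = {w \<in> coord_space J. (\<Sum>j\<in>J. fscale (w $ j) (\<beta> j)) = 0}"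


section \<open>The data attached to a support\<close>

definition singular_support :: "('n::finite \<Rightarrow> complex^'k \<Rightarrow> complex) \<Rightarrow> 'n set \<Rightarrow> bool" where
  "singular_support \<Lambda> I \<longleftrightarrow> weight_rank \<Lambda> I < CARD('k)"

definition isotropy :: "('n::finite \<Rightarrow> complex^'k \<Rightarrow> complex) \<Rightarrow> 'n set \<Rightarrow> (complex^'k) set" where
  "isotropy \<Lambda> I = {t. \<forall>i\<in>I. \<Lambda> i t = 0}"

definition residual_weight ::
  "('n::finite \<Rightarrow> complex^'k \<Rightarrow> complex) \<Rightarrow> 'n set \<Rightarrow> 'n \<Rightarrow> complex^'k \<Rightarrow> complex" where
  "residual_weight \<Lambda> I j = (\<lambda>t. if t \<in> isotropy \<Lambda> I then \<Lambda> j t else 0)"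

definition support_semigroup ::
  "('n::finite \<Rightarrow> complex^'k \<Rightarrow> complex) \<Rightarrow> 'n set \<Rightarrow> (nat^'n) set" where
  "support_semigroup \<Lambda> I = resonance_semigroup (- I) (residual_weight \<Lambda> I)"

definition support_group ::
  "('n::finite \<Rightarrow> complex^'k \<Rightarrow> complex) \<Rightarrow> 'n set \<Rightarrow> (int^'n) set" where
  "support_group \<Lambda> I = module.span (*s) ((\<lambda>\<alpha>. \<chi> j. int (\<alpha> $ j)) ` support_semigroup \<Lambda> I)"

definition group_rank :: "(int^'n::finite) set \<Rightarrow> nat" where
  "group_rank M = Max (card ` {B. B \<subseteq> M \<and> finite B \<and> \<not> module.dependent (*s) B})"

text \<open>The image of \<open>M\<^sub>I \<otimes> \<complex>\<close> in \<open>\<complex>\<^sup>J\<close>.\<close>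

definition resonance_space ::
  "('n::finite \<Rightarrow> complex^'k \<Rightarrow> complex) \<Rightarrow> 'n set \<Rightarrow> (complex^'n) set" where
  "resonance_space \<Lambda> I = vec.span ((\<lambda>m. \<chi> j. of_int (m $ j)) ` support_group \<Lambda> I)"

text \<open>The dimension of the affine toric variety \<open>Spec \<complex>[S\<^sub>I]\<close> is the rank of the group generated
  by \<open>S\<^sub>I\<close>.\<close>

definition envelope_dim :: "('n::finite \<Rightarrow> complex^'k \<Rightarrow> complex) \<Rightarrow> 'n set \<Rightarrow> nat" where
  "envelope_dim \<Lambda> I = group_rank (support_group \<Lambda> I)"

text \<open>Under uniform maximal rank the subtractions in the next two definitions are exact.\<close>

definition residual_dim :: "('n::finite \<Rightarrow> complex^'k \<Rightarrow> complex) \<Rightarrow> 'n set \<Rightarrow> nat" where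
  "residual_dim \<Lambda> I = CARD('k) - card I"

definition defect :: "('n::finite \<Rightarrow> complex^'k \<Rightarrow> complex) \<Rightarrow> 'n set \<Rightarrow> nat" where
  "defect \<Lambda> I = (CARD('n) - CARD('k)) - envelope_dim \<Lambda> I"

definition same_envelope_configs ::
  "('n::finite \<Rightarrow> complex^'k \<Rightarrow> complex) \<Rightarrow> 'n set \<Rightarrow> ('n \<Rightarrow> complex^'k \<Rightarrow> complex) set" where
  "same_envelope_configs \<Lambda> I =
     {\<beta>. residual_configuration (- I) (residual_dim \<Lambda> I) \<beta> \<and>
         uniform_maximal_rank (- I) (residual_dim \<Lambda> I) \<beta> \<and>
         resonance_semigroup (- I) \<beta> = support_semigroup \<Lambda> I}"

definition equivalence_on_configs ::
  "('n::finite \<Rightarrow> complex^'k \<Rightarrow> complex) \<Rightarrow> 'n set \<Rightarrow>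
     (('n \<Rightarrow> complex^'k \<Rightarrow> complex) \<times> ('n \<Rightarrow> complex^'k \<Rightarrow> complex)) set" where
  "equivalence_on_configs \<Lambda> I =
     {(\<beta>, \<gamma>). \<beta> \<in> same_envelope_configs \<Lambda> I \<and> \<gamma> \<in> same_envelope_configs \<Lambda> I \<and>
              linearly_equivalent (- I) \<beta> \<gamma>}"


section \<open>Grassmannians of quotient spaces\<close>

text \<open>Here \<open>R \<subseteq> V\<close> are complex subspaces of \<^typ>\<open>complex^'n\<close>. A vector of \<open>V/R\<close> is a coset, and
  \<open>quotient_image R K\<close> is \<open>K/R\<close>; the linear subspaces of \<open>V/R\<close> are the \<open>K/R\<close> with
  \<open>R \<subseteq> K \<subseteq> V\<close>, and \<open>dim (K/R) = dim K - dim R\<close>.\<close>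

definition quotient_image :: "(complex^'n::finite) set \<Rightarrow> (complex^'n) set \<Rightarrow> (complex^'n) set set" where
  "quotient_image R K = (\<lambda>v. (+) v ` R) ` K"

definition grassmannian ::
  "(complex^'n::finite) set \<Rightarrow> (complex^'n) set \<Rightarrow> nat \<Rightarrow> (complex^'n) set set set" where
  "grassmannian V R m =
     {quotient_image R K | K.
        vec.subspace K \<and> R \<subseteq> K \<and> K \<subseteq> V \<and> vec.dim K = vec.dim R + m}"

text \<open>\<open>m\<close>-tuples in \<open>V\<close> whose classes in \<open>V/R\<close> are linearly independent.\<close>

definition quotient_frames ::
  "(complex^'n::finite) set \<Rightarrow> (complex^'n) set \<Rightarrow> nat \<Rightarrow> (nat \<Rightarrow> complex^'n) set" where
  "quotient_frames V R m =
     {F \<in> {..<m} \<rightarrow>\<^sub>E V. \<forall>a. (\<Sum>i<m. a i *s F i) \<in> R \<longrightarrow> (\<forall>i<m. a i = 0)}"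

text \<open>The subspace of \<open>V/R\<close> spanned by the classes of such a tuple.\<close>

definition frame_span ::
  "(complex^'n::finite) set \<Rightarrow> nat \<Rightarrow> (nat \<Rightarrow> complex^'n) \<Rightarrow> (complex^'n) set set" where
  "frame_span R m F = quotient_image R (vec.span (F ` {..<m}))"

definition frame_topology ::
  "(complex^'n::finite) set \<Rightarrow> (complex^'n) set \<Rightarrow> nat \<Rightarrow> (nat \<Rightarrow> complex^'n) topology" where
  "frame_topology V R m =
     subtopology (product_topology (\<lambda>_. top_of_set V) {..<m}) (quotient_frames V R m)"

text \<open>The Euclidean topology of the Grassmannian is the quotient topology from the space of
  linearly independent \<open>m\<close>-tuples in \<open>V/R\<close>. As \<open>V\<^sup>m \<rightarrow> (V/R)\<^sup>m\<close> is an open quotient map, tuples in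
  \<open>V\<close> give the same topology.\<close>

definition grassmannian_topology ::
  "(complex^'n::finite) set \<Rightarrow> (complex^'n) set \<Rightarrow> nat \<Rightarrow> (complex^'n) set set topology" where
  "grassmannian_topology V R m =
     topology (\<lambda>U. U \<subseteq> grassmannian V R m \<and>
       openin (frame_topology V R m) {F \<in> quotient_frames V R m. frame_span R m F \<in> U})"

lemma openin_grassmannian_topology:
  "openin (grassmannian_topology V R m) U \<longleftrightarrow> U \<subseteq> grassmannian V R m \<and>
     openin (frame_topology V R m) {F \<in> quotient_frames V R m. frame_span R m F \<in> U}"
proof -
  let ?Q = "\<lambda>U. {F \<in> quotient_frames V R m. frame_span R m F \<in> U}"
  have "istopology (\<lambda>U. U \<subseteq> grassmannian V R m \<and> openin (frame_topology V R m) (?Q U))"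
    unfolding istopology_def
  proof (intro conjI allI impI)
    fix S T
    assume "S \<subseteq> grassmannian V R m \<and> openin (frame_topology V R m) (?Q S)"
      and "T \<subseteq> grassmannian V R m \<and> openin (frame_topology V R m) (?Q T)"
    moreover have "?Q (S \<inter> T) = ?Q S \<inter> ?Q T" by auto
    ultimately show "S \<inter> T \<subseteq> grassmannian V R m"
      and "openin (frame_topology V R m) (?Q (S \<inter> T))" by auto
  next
    fix \<K>
    assume *: "\<forall>K\<in>\<K>. K \<subseteq> grassmannian V R m \<and> openin (frame_topology V R m) (?Q K)"
    have "?Q (\<Union>\<K>) = \<Union>(?Q ` \<K>)" by auto
    with * show "\<Union>\<K> \<subseteq> grassmannian V R m"
      and "openin (frame_topology V R m) (?Q (\<Union>\<K>))" by auto
  qed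
  then show ?thesis
    by (simp add: grassmannian_topology_def topology_inverse')
qed

lemma frame_span_in_grassmannian:
  assumes V: "vec.subspace V" and R: "vec.subspace R" and RV: "R \<subseteq> V"
    and F: "F \<in> quotient_frames V R m"
  shows "frame_span R m F \<in> grassmannian V R m"
proof -
  let ?B = "F ` {..<m}" and ?L = "vec.span (F ` {..<m})"
  let ?K = "{x + y |x y. x \<in> ?L \<and> y \<in> R}"
  have FV: "F i \<in> V" if "i < m" for i
    using F that by (auto simp: quotient_frames_def)
  have ind: "a i = 0" if "(\<Sum>i<m. a i *s F i) \<in> R" "i < m" for a i
    using F that by (auto simp: quotient_frames_def)
  have R0: "0 \<in> R" using R by (rule vec.subspace_0)
  have inj: "inj_on F {..<m}"
  proof (rule inj_onI)
    fix i j assume ij: "i \<in> {..<m}" "j \<in> {..<m}" "F i = F j"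
    show "i = j"
    proof (rule ccontr)
      assume "i \<noteq> j"
      define a :: "nat \<Rightarrow> complex" where "a l = (if l = i then 1 else 0) - (if l = j then 1 else 0)" for l
      have "(\<Sum>l<m. a l *s F l) = (\<Sum>l<m. (if l = i then F l else 0)) - (\<Sum>l<m. (if l = j then F l else 0))"
        unfolding sum_subtractf [symmetric] a_def
        by (intro sum.cong refl) (auto simp: vector_ssub_ldistrib)
      also have "\<dots> = 0" using ij by (simp add: sum.delta)
      finally have "a i = 0" using ind ij R0 by simp
      then show False using \<open>i \<noteq> j\<close> by (simp add: a_def)
    qed
  qed
  have span: "\<exists>a. x = (\<Sum>i<m. a i *s F i)" if "x \<in> ?L" for x
  proof -
    from that obtain u where "x = (\<Sum>v\<in>?B. u v *s v)"
      by (auto simp: vec.span_finite)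
    also have "\<dots> = (\<Sum>i<m. u (F i) *s F i)"
      using inj by (simp add: sum.reindex)
    finally show ?thesis by (rule exI [of _ "\<lambda>i. u (F i)"])
  qed
  have int: "?L \<inter> R = {0}"
  proof -
    have "x = 0" if "x \<in> ?L" "x \<in> R" for x
    proof -
      from span [OF that(1)] obtain a where x: "x = (\<Sum>i<m. a i *s F i)" by blast
      with that(2) ind have "\<And>i. i < m \<Longrightarrow> a i = 0" by blast
      then show ?thesis by (simp add: x)
    qed
    then show ?thesis using R0 vec.span_zero by blast
  qed
  have indep: "vec.independent ?B"
  proof (rule vec.independent_if_scalars_zero)
    fix u x assume "(\<Sum>v\<in>?B. u v *s v) = 0" and x: "x \<in> ?B"
    then have "(\<Sum>i<m. u (F i) *s F i) \<in> R"
      using R0 inj by (simp add: sum.reindex)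
    with ind [of "\<lambda>i. u (F i)"] x show "u x = 0" by auto
  qed simp
  have dimL: "vec.dim ?L = m"
    using indep inj by (simp add: vec.dim_span vec.dim_eq_card_independent card_image)
  have subK: "vec.subspace ?K"
    using vec.subspace_sums [OF vec.subspace_span R] .
  have "vec.dim ?K + vec.dim (?L \<inter> R) = vec.dim ?L + vec.dim R"
    by (rule vec.dim_sums_Int [OF vec.subspace_span R])
  then have dimK: "vec.dim ?K = vec.dim R + m"
    using dimL vec.dim_insert [of 0 "{}"] by (simp add: int vec.span_zero)
  have RK: "R \<subseteq> ?K"
    using vec.span_zero by force
  have KV: "?K \<subseteq> V"
  proof -
    have "?L \<subseteq> V"
      using FV V by (intro vec.span_minimal) auto
    then show ?thesis using RV V vec.subspace_add by blast
  qed
  have coset: "(+) (x + y) ` R = (+) x ` R" if "y \<in> R" for x y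
  proof
    show "(+) (x + y) ` R \<subseteq> (+) x ` R"
      using that R vec.subspace_add by (force simp: add.assoc)
    show "(+) x ` R \<subseteq> (+) (x + y) ` R"
    proof
      fix z assume "z \<in> (+) x ` R"
      then obtain r where r: "r \<in> R" "z = x + r" by blast
      then have "z = (x + y) + (r - y)" by simp
      moreover have "r - y \<in> R" using r that R vec.subspace_diff by blast
      ultimately show "z \<in> (+) (x + y) ` R" by blast
    qed
  qed
  have "frame_span R m F = quotient_image R ?K"
  proof
    show "frame_span R m F \<subseteq> quotient_image R ?K"
      unfolding frame_span_def quotient_image_def using R0 by force
    show "quotient_image R ?K \<subseteq> frame_span R m F"
      unfolding frame_span_def quotient_image_def using coset by auto
  qed
  then show ?thesis
    unfolding grassmannian_def using subK RK KV dimK by blast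
qed

lemma topspace_grassmannian_topology:
  assumes "vec.subspace V" "vec.subspace R" "R \<subseteq> V"
  shows "topspace (grassmannian_topology V R m) = grassmannian V R m"
proof
  show "topspace (grassmannian_topology V R m) \<subseteq> grassmannian V R m"
    using openin_topspace [of "grassmannian_topology V R m"]
    unfolding openin_grassmannian_topology by blast
  have "{F \<in> quotient_frames V R m. frame_span R m F \<in> grassmannian V R m} = quotient_frames V R m"
    using frame_span_in_grassmannian [OF assms] by blast
  moreover have "topspace (frame_topology V R m) = quotient_frames V R m"
    by (auto simp: frame_topology_def quotient_frames_def)
  ultimately have "openin (grassmannian_topology V R m) (grassmannian V R m)"
    unfolding openin_grassmannian_topology by (metis openin_topspace order_refl)
  then show "grassmannian V R m \<subseteq> topspace (grassmannian_topology V R m)"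
    by (rule openin_subset)
qed

text \<open>A chart with values in an open subset of \<open>\<complex>\<^sup>r\<close>, together with a lift \<open>\<sigma>\<close> of its inverse to
  tuples. Both \<open>\<phi> \<circ> frame_span\<close> and \<open>\<sigma>\<close> are holomorphic, that is, continuous and complex
  differentiable along every complex line; these are the charts of the complex manifold structure
  induced from \<open>V\<^sup>m\<close>, and changes of charts are holomorphic.\<close>

definition grassmannian_chart ::
  "(complex^'n::finite) set \<Rightarrow> (complex^'n) set \<Rightarrow> nat \<Rightarrow> nat \<Rightarrow> (complex^'n) set set set \<Rightarrow>
     ((complex^'n) set set \<Rightarrow> nat \<Rightarrow> complex) \<Rightarrow> ((nat \<Rightarrow> complex) \<Rightarrow> nat \<Rightarrow> complex^'n) \<Rightarrow> bool" where
  "grassmannian_chart V R m r U \<phi> \<sigma> \<longleftrightarrow>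
     (let X = grassmannian_topology V R m;
          E = product_topology (\<lambda>_. euclidean) {..<r}
      in openin X U \<and> openin E (\<phi> ` U) \<and>
         homeomorphic_map (subtopology X U) (subtopology E (\<phi> ` U)) \<phi> \<and>
         (\<forall>F\<in>quotient_frames V R m. frame_span R m F \<in> U \<longrightarrow>
            (\<forall>H\<in>{..<m} \<rightarrow>\<^sub>E V. \<forall>l<r.
               (\<lambda>t::complex. \<phi> (frame_span R m (\<lambda>i\<in>{..<m}. F i + t *s H i)) l)
                 field_differentiable at 0)) \<and>
         continuous_map (subtopology E (\<phi> ` U)) (frame_topology V R m) \<sigma> \<and>
         (\<forall>P\<in>U. frame_span R m (\<sigma> (\<phi> P)) = P) \<and>
         (\<forall>x\<in>\<phi> ` U. \<forall>y\<in>{..<r} \<rightarrow>\<^sub>E UNIV. \<forall>i<m. \<forall>j.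
            (\<lambda>t::complex. \<sigma> (\<lambda>l\<in>{..<r}. x l + t * y l) i $ j) field_differentiable at 0))"

definition grassmannian_has_dim ::
  "(complex^'n::finite) set \<Rightarrow> (complex^'n) set \<Rightarrow> nat \<Rightarrow> nat \<Rightarrow> bool" where
  "grassmannian_has_dim V R m r \<longleftrightarrow>
     grassmannian V R m \<noteq> {} \<and>
     (\<forall>P\<in>grassmannian V R m. \<exists>U \<phi> \<sigma>. P \<in> U \<and> grassmannian_chart V R m r U \<phi> \<sigma>)"

end

theory Submission
  imports Defs
begin

text \<open>Everything is read off the relation space \<open>K \<subseteq> \<complex>\<^sup>J\<close> of a configuration: linear equivalence is equality
  of relation spaces, uniform maximal rank says that \<open>K\<close> meets the coordinate subspaces of dimension
  \<open>d\<^sub>I\<close> trivially, and having resonance semigroup \<open>S\<^sub>I\<close> says that \<open>K\<close> contains \<open>R\<^sub>I\<close> and meets the line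
  through each \<open>\<alpha> \<in> \<nat>\<^sup>J\<close> outside \<open>S\<^sub>I\<close> trivially. So the classes correspond to the \<open>K/R\<^sub>I\<close> that meet countably many
  subspaces trivially, and the given configuration is one of them. Each single condition is open, and along a complex line of
  frames through the given one it fails at finitely many parameters only, namely at roots of a
  determinant. Hence all conditions hold along the line outside a countable set, which yields both
  density and uncountably many classes, without appeal to Baire's theorem.\<close>

section \<open>Relation spaces\<close>

text \<open>Points of the Grassmannian are handled through frames, since its topology is a quotient
  of the space of m-tuples independent modulo R. Meeting a subspace C trivially is then a condition
  of the same kind as being a frame: the tuple must be independent modulo R + C. Openness and the
  finiteness of the exceptional parameters are thus proved once, for tuples independent modulo an
  arbitrary subspace, and used for R and for every R + C. This translation requires that R itself
  meets C trivially, which holds because the relation space of the residual weights contains R and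
  avoids C. The number m is not a type, so instead of a determinant of size m one of size n is used,
  of a matrix that fixes all vectors killed by the dual functionals. It witnesses independence, it
  is a polynomial along lines, it describes the chart domains and, through Cramer's rule, it makes
  the charts rational functions of the frame. One arithmetic point remains:
  \<open>envelope_dim\<close> counts vectors independent over the integers, whereas R is a complex
  span.\<close>

interpretation fun_pair: vector_space_pair fscale fscale
  by (intro vector_space_pair.intro vector_space_fscale)

lemma fscale_apply: "fscale c f x = c * f x"
  by (simp add: fscale_def)

lemma sum_fun_apply: "(\<Sum>x\<in>A. f x) y = (\<Sum>x\<in>A. f x y)"
  by (induction A rule: infinite_finite_induct) auto

lemma subspace_coord_space: "vec.subspace (coord_space J)"
  by (auto simp: vec.subspace_def coord_space_def)

lemma dim_coord_space: "vec.dim (coord_space J) = card J"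
  unfolding coord_space_def by (rule dim_substandard_cart)

lemma coord_space_mono: "T \<subseteq> J \<Longrightarrow> coord_space T \<subseteq> coord_space J"
  by (auto simp: coord_space_def)

lemma axis_in_coord_space: "j \<in> J \<Longrightarrow> axis j 1 \<in> coord_space J"
  by (auto simp: coord_space_def axis_def)

lemma subspace_relation_space: "vec.subspace (relation_space J \<beta>)"
proof -
  have "(\<Sum>j\<in>J. fscale (x $ j + y $ j) (\<beta> j)) =
      (\<Sum>j\<in>J. fscale (x $ j) (\<beta> j)) + (\<Sum>j\<in>J. fscale (y $ j) (\<beta> j))" for x y :: "complex^'a"
    by (simp add: fun_vs.scale_left_distrib sum.distrib)
  moreover have "(\<Sum>j\<in>J. fscale (c * x $ j) (\<beta> j)) = fscale c (\<Sum>j\<in>J. fscale (x $ j) (\<beta> j))"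
    for c and x :: "complex^'a"
    by (simp add: fun_vs.scale_sum_right)
  ultimately show ?thesis
    by (auto simp: vec.subspace_def coord_space_def relation_space_def)
qed

lemma relation_space_subset: "relation_space J \<beta> \<subseteq> coord_space J"
  by (auto simp: relation_space_def)

text \<open>Dropping labels amounts to intersecting with a coordinate subspace. Through this, rank
  conditions on all subfamilies become conditions on the one subspace
  \<open>relation_space J \<beta>\<close>.\<close>

lemma relation_space_Int_coord_space:
  assumes "T \<subseteq> J"
  shows "relation_space J \<beta> \<inter> coord_space T = relation_space T \<beta>"
proof -
  have "(\<Sum>j\<in>J. fscale (w $ j) (\<beta> j)) = (\<Sum>j\<in>T. fscale (w $ j) (\<beta> j))"
    if "w \<in> coord_space T" for w
    using that assms by (intro sum.mono_neutral_right) (auto simp: coord_space_def)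
  then show ?thesis
    using coord_space_mono [OF assms] by (auto simp: relation_space_def)
qed

text \<open>Coefficients are indexed by labels and not by vectors, so that equal weights with
  different labels keep separate coefficients.\<close>

lemma span_image_sum:
  fixes \<beta> :: "'n::finite \<Rightarrow> 'a \<Rightarrow> complex"
  shows "fun_vs.span (\<beta> ` T) = (\<lambda>w. \<Sum>j\<in>T. fscale (w $ j) (\<beta> j)) ` coord_space T"
proof
  let ?L = "\<lambda>w :: complex^'n. \<Sum>j\<in>T. fscale (w $ j) (\<beta> j)"
  have "\<beta> j \<in> ?L ` coord_space T" if "j \<in> T" for j
  proof
    show "axis j 1 \<in> coord_space T"
      using that by (rule axis_in_coord_space)
    have "?L (axis j 1) = (\<Sum>i\<in>T. if i = j then \<beta> i else 0)"
      by (intro sum.cong) (auto simp: axis_def)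
    then show "\<beta> j = ?L (axis j 1)" using that by simp
  qed
  moreover have "fun_vs.subspace (?L ` coord_space T)"
  proof (rule fun_vs.subspaceI)
    show "0 \<in> ?L ` coord_space T"
      by (rule image_eqI [of _ _ 0]) (auto simp: coord_space_def)
    fix x y c
    assume "x \<in> ?L ` coord_space T"
    then obtain u where u: "x = ?L u" "u \<in> coord_space T" by blast
    show "fscale c x \<in> ?L ` coord_space T"
      using u by (intro image_eqI [of _ _ "c *s u"])
        (auto simp: coord_space_def fun_vs.scale_sum_right)
    assume "y \<in> ?L ` coord_space T"
    then obtain v where v: "y = ?L v" "v \<in> coord_space T" by blast
    show "x + y \<in> ?L ` coord_space T"
      using u v by (intro image_eqI [of _ _ "u + v"])
        (auto simp: coord_space_def fun_vs.scale_left_distrib sum.distrib)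
  qed
  ultimately show "fun_vs.span (\<beta> ` T) \<subseteq> ?L ` coord_space T"
    by (intro fun_vs.span_minimal) auto
  show "?L ` coord_space T \<subseteq> fun_vs.span (\<beta> ` T)"
    by (auto intro!: fun_vs.span_sum fun_vs.span_scale intro: fun_vs.span_base)
qed

text \<open>Besides basis vectors one needs a label for each of them, chosen once, because several
  labels may carry the same weight.\<close>

lemma basis_labels_exist:
  fixes \<beta> :: "'n::finite \<Rightarrow> 'a \<Rightarrow> complex"
  obtains S where "S \<subseteq> T" "inj_on \<beta> S" "fun_vs.independent (\<beta> ` S)"
    "\<beta> ` T \<subseteq> fun_vs.span (\<beta> ` S)" "card S = fun_vs.dim (\<beta> ` T)"
proof -
  obtain B where B: "B \<subseteq> \<beta> ` T" "fun_vs.independent B" "\<beta> ` T \<subseteq> fun_vs.span B"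
    "card B = fun_vs.dim (\<beta> ` T)"
    using fun_vs.basis_exists by blast
  obtain S where "S \<subseteq> T" "B = \<beta> ` S" "inj_on \<beta> S"
    using subset_image_inj [of B \<beta> T] B(1) by blast
  then show thesis
    using that [of S] B by (simp add: card_image)
qed

text \<open>Independence of a set of vectors does not see repetitions, whereas equal weights with
  different labels do give a relation; hence the injectivity on the right.\<close>

lemma relation_space_trivial_iff:
  "relation_space S \<beta> = {0} \<longleftrightarrow> inj_on \<beta> S \<and> fun_vs.independent (\<beta> ` S)"
proof
  assume *: "relation_space S \<beta> = {0}"
  have **: "u j = 0" if "(\<Sum>j\<in>S. fscale (u j) (\<beta> j)) = 0" "j \<in> S" for u j
  proof -
    have "(\<chi> j. if j \<in> S then u j else 0) \<in> relation_space S \<beta>"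
      using that by (auto simp: relation_space_def coord_space_def)
    then have "(\<chi> j. if j \<in> S then u j else 0) = 0"
      using * by auto
    then have "(\<chi> j. if j \<in> S then u j else 0) $ j = 0"
      by simp
    then show ?thesis using that by simp
  qed
  have inj: "inj_on \<beta> S"
  proof (rule inj_onI, rule ccontr)
    fix i j assume ij: "i \<in> S" "j \<in> S" "\<beta> i = \<beta> j" "i \<noteq> j"
    define u :: "'a \<Rightarrow> complex" where "u l = (if l = i then 1 else if l = j then - 1 else 0)" for l
    have "(\<Sum>l\<in>S. fscale (u l) (\<beta> l)) = (\<Sum>l\<in>{i, j}. fscale (u l) (\<beta> l))"
      using ij by (intro sum.mono_neutral_right) (auto simp: u_def)
    also have "\<dots> = 0"
      using ij by (simp add: u_def fun_vs.scale_minus_left)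
    finally have "u i = 0" using ** ij by blast
    then show False by (simp add: u_def)
  qed
  moreover have "fun_vs.independent (\<beta> ` S)"
  proof (rule fun_vs.independent_if_scalars_zero)
    fix f x assume "(\<Sum>x\<in>\<beta> ` S. fscale (f x) x) = 0" "x \<in> \<beta> ` S"
    then show "f x = 0"
      using inj ** [of "\<lambda>j. f (\<beta> j)"] by (auto simp: sum.reindex)
  qed auto
  ultimately show "inj_on \<beta> S \<and> fun_vs.independent (\<beta> ` S)" by blast
next
  assume *: "inj_on \<beta> S \<and> fun_vs.independent (\<beta> ` S)"
  have "w = 0" if "w \<in> relation_space S \<beta>" for w
  proof -
    have "(\<Sum>x\<in>\<beta> ` S. fscale (w $ inv_into S \<beta> x) x) = (\<Sum>j\<in>S. fscale (w $ j) (\<beta> j))"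
      using * by (simp add: sum.reindex)
    also have "\<dots> = 0" using that by (simp add: relation_space_def)
    finally have "w $ inv_into S \<beta> (\<beta> j) = 0" if "j \<in> S" for j
      using * that fun_vs.independentD [of "\<beta> ` S" "\<beta> ` S" "\<lambda>x. w $ inv_into S \<beta> x" "\<beta> j"]
      by auto
    then have "w $ j = 0" for j
      using * \<open>w \<in> relation_space S \<beta>\<close>
      by (cases "j \<in> S") (auto simp: relation_space_def coord_space_def)
    then show ?thesis by (simp add: vec_eq_iff)
  qed
  then show "relation_space S \<beta> = {0}"
    using vec.subspace_0 [OF subspace_relation_space] by blast
qed

text \<open>Rank-nullity for the map that sends w to the combination of the weights with
  coefficients w. The coordinate space over the labels of a basis is a complement of the kernel, so
  dimensions are counted among coefficient vectors although the covectors live in an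
  infinite-dimensional space.\<close>

lemma weight_rank_plus_dim_relation_space:
  "weight_rank \<beta> T + vec.dim (relation_space T \<beta>) = card T"
proof -
  obtain S where S: "S \<subseteq> T" "inj_on \<beta> S" "fun_vs.independent (\<beta> ` S)"
    "\<beta> ` T \<subseteq> fun_vs.span (\<beta> ` S)" "card S = fun_vs.dim (\<beta> ` T)"
    by (rule basis_labels_exist)
  have int: "coord_space S \<inter> relation_space T \<beta> = {0}"
    using relation_space_Int_coord_space [OF S(1)] S(2,3) relation_space_trivial_iff by blast
  have "coord_space T = {x + y |x y. x \<in> coord_space S \<and> y \<in> relation_space T \<beta>}" (is "_ = ?K")
  proof
    show "?K \<subseteq> coord_space T"
      using relation_space_subset [of T \<beta>] coord_space_mono [OF S(1)] subspace_coord_space [of T]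
      by (auto intro!: vec.subspace_add)
    show "coord_space T \<subseteq> ?K"
    proof
      fix w :: "complex^'a" assume w: "w \<in> coord_space T"
      have "(\<Sum>j\<in>T. fscale (w $ j) (\<beta> j)) \<in> fun_vs.span (\<beta> ` S)"
        using S(4) by (auto intro!: fun_vs.span_sum fun_vs.span_scale)
      then obtain v where v: "v \<in> coord_space S"
        "(\<Sum>j\<in>T. fscale (w $ j) (\<beta> j)) = (\<Sum>j\<in>S. fscale (v $ j) (\<beta> j))"
        unfolding span_image_sum by blast
      have "(\<Sum>j\<in>S. fscale (v $ j) (\<beta> j)) = (\<Sum>j\<in>T. fscale (v $ j) (\<beta> j))"
        using v S(1) by (intro sum.mono_neutral_left) (auto simp: coord_space_def)
      with v w have "w - v \<in> relation_space T \<beta>"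
        using coord_space_mono [OF S(1)] subspace_coord_space [of T]
        by (auto simp: relation_space_def fun_vs.scale_left_diff_distrib sum_subtractf
            intro: vec.subspace_diff)
      with v show "w \<in> ?K" by force
    qed
  qed
  then show ?thesis
    using vec.dim_sums_Int [OF subspace_coord_space subspace_relation_space, of S T \<beta>] S(5)
      dim_coord_space [of T] dim_coord_space [of S] vec.dim_insert [of 0 "{}"]
    by (simp add: int weight_rank_def vec.dim_singleton)
qed

text \<open>All functions together form an infinite-dimensional space, so the comparison runs
  through the finite set of weights that spans those with labels in \<open>J\<close>.\<close>

lemma weight_rank_mono:
  assumes "T \<subseteq> J"
  shows "weight_rank \<beta> T \<le> weight_rank \<beta> J"
proof -
  obtain S where S: "S \<subseteq> J" "inj_on \<beta> S" "fun_vs.independent (\<beta> ` S)"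
    "\<beta> ` J \<subseteq> fun_vs.span (\<beta> ` S)" "card S = fun_vs.dim (\<beta> ` J)"
    by (rule basis_labels_exist)
  have "fun_vs.dim (\<beta> ` T) \<le> card (\<beta> ` S)"
    using assms S by (intro fun_vs.dim_le_card) auto
  also have "\<dots> \<le> card S" by (rule card_image_le) simp
  finally show ?thesis using S by (simp add: weight_rank_def)
qed

lemma weight_rank_eq_card_iff:
  "weight_rank \<beta> T = card T \<longleftrightarrow> relation_space T \<beta> = {0}"
proof -
  have "weight_rank \<beta> T = card T \<longleftrightarrow> vec.dim (relation_space T \<beta>) = 0"
    using weight_rank_plus_dim_relation_space [of \<beta> T] by linarith
  also have "\<dots> \<longleftrightarrow> relation_space T \<beta> \<subseteq> {0}" by simp
  finally show ?thesis
    using vec.subspace_0 [OF subspace_relation_space] by blast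
qed

text \<open>Sets of exactly \<open>d\<close> labels decide: a smaller set lies in one of them and
  inherits its independence, a larger set contains one and its rank is squeezed between
  \<open>d\<close> and the rank over \<open>J\<close>.\<close>

lemma uniform_maximal_rank_iff:
  assumes "weight_rank \<beta> J = d"
  shows "uniform_maximal_rank J d \<beta> \<longleftrightarrow> (\<forall>T\<subseteq>J. card T = d \<longrightarrow> relation_space T \<beta> = {0})"
proof
  assume "uniform_maximal_rank J d \<beta>"
  then show "\<forall>T\<subseteq>J. card T = d \<longrightarrow> relation_space T \<beta> = {0}"
    by (auto simp: uniform_maximal_rank_def simp flip: weight_rank_eq_card_iff)
next
  assume *: "\<forall>T\<subseteq>J. card T = d \<longrightarrow> relation_space T \<beta> = {0}"
  have dJ: "d \<le> card J"
    using weight_rank_plus_dim_relation_space [of \<beta> J] assms by linarith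
  have "weight_rank \<beta> T = min (card T) d" if T: "T \<subseteq> J" for T
  proof (cases "card T \<le> d")
    case True
    obtain T' where T': "T \<subseteq> T'" "T' \<subseteq> J" "card T' = d"
      using exists_subset_between [OF True dJ T] by (auto simp: finite_subset)
    then have "relation_space T \<beta> = {0}"
      using * relation_space_Int_coord_space [OF T'(1), of \<beta>]
        vec.subspace_0 [OF subspace_relation_space] by blast
    then show ?thesis using True by (simp add: weight_rank_eq_card_iff)
  next
    case False
    then obtain T' where T': "T' \<subseteq> T" "card T' = d"
      using obtain_subset_with_card_n [of d T] by auto
    then have "weight_rank \<beta> T' = d"
      using * T weight_rank_eq_card_iff [of \<beta> T'] by (metis order_trans)
    then show ?thesis
      using weight_rank_mono [OF T'(1), of \<beta>] weight_rank_mono [OF T, of \<beta>] assms False by linarith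
  qed
  then show "uniform_maximal_rank J d \<beta>"
    by (simp add: uniform_maximal_rank_def)
qed

text \<open>The span with its labelled weights is the quotient of \<open>coord_space J\<close> by
  the relation space, which is therefore a complete invariant.\<close>

lemma linearly_equivalent_iff:
  "linearly_equivalent J \<beta> \<gamma> \<longleftrightarrow> relation_space J \<beta> = relation_space J \<gamma>"
proof
  assume "linearly_equivalent J \<beta> \<gamma>"
  then obtain f where f: "Vector_Spaces.linear fscale fscale f"
    and bij: "bij_betw f (fun_vs.span (\<beta> ` J)) (fun_vs.span (\<gamma> ` J))"
    and f\<beta>: "\<And>j. j \<in> J \<Longrightarrow> f (\<beta> j) = \<gamma> j"
    unfolding linearly_equivalent_def by blast
  have "(\<Sum>j\<in>J. fscale (w $ j) (\<beta> j)) = 0 \<longleftrightarrow> (\<Sum>j\<in>J. fscale (w $ j) (\<gamma> j)) = 0" for w :: "complex^'a"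
  proof -
    have eq: "f (\<Sum>j\<in>J. fscale (w $ j) (\<beta> j)) = (\<Sum>j\<in>J. fscale (w $ j) (\<gamma> j))"
      using f\<beta> by (simp add: fun_pair.linear_sum [OF f] fun_pair.linear_scale [OF f])
    have "(\<Sum>j\<in>J. fscale (w $ j) (\<beta> j)) \<in> fun_vs.span (\<beta> ` J)"
      by (auto intro!: fun_vs.span_sum fun_vs.span_scale intro: fun_vs.span_base)
    moreover have "f x = 0 \<longleftrightarrow> x = 0" if "x \<in> fun_vs.span (\<beta> ` J)" for x
      using inj_on_eq_iff [OF bij_betw_imp_inj_on [OF bij] that fun_vs.span_zero]
      by (simp add: fun_pair.linear_0 [OF f])
    ultimately show ?thesis
      using eq by metis
  qed
  then show "relation_space J \<beta> = relation_space J \<gamma>"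
    by (simp add: relation_space_def)
next
  assume rel: "relation_space J \<beta> = relation_space J \<gamma>"
  obtain S where S: "S \<subseteq> J" "inj_on \<beta> S" "fun_vs.independent (\<beta> ` S)"
    "\<beta> ` J \<subseteq> fun_vs.span (\<beta> ` S)" "card S = fun_vs.dim (\<beta> ` J)"
    by (rule basis_labels_exist)
  \<comment> \<open>Only the labels of a basis are prescribed; that the remaining labels follow is
    where the equality of relation spaces enters.\<close>
  obtain f where f: "Vector_Spaces.linear fscale fscale f"
    and fS: "\<And>x. x \<in> \<beta> ` S \<Longrightarrow> f x = \<gamma> (inv_into S \<beta> x)"
    using fun_pair.linear_independent_extend [OF S(3), of "\<lambda>x. \<gamma> (inv_into S \<beta> x)"] by blast
  have f\<beta>: "f (\<beta> j) = \<gamma> j" if j: "j \<in> J" for j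
  proof -
    from S(4) j obtain v where v: "v \<in> coord_space S" "\<beta> j = (\<Sum>i\<in>S. fscale (v $ i) (\<beta> i))"
      unfolding span_image_sum by blast
    have vJ: "(\<Sum>i\<in>S. fscale (v $ i) (\<eta> i)) = (\<Sum>i\<in>J. fscale (v $ i) (\<eta> i))"
      for \<eta> :: "'a \<Rightarrow> complex^'b \<Rightarrow> complex"
      using v S(1) by (intro sum.mono_neutral_left) (auto simp: coord_space_def)
    have ax: "(\<Sum>i\<in>J. fscale (axis j 1 $ i) (\<eta> i)) = \<eta> j"
      for \<eta> :: "'a \<Rightarrow> complex^'b \<Rightarrow> complex"
    proof -
      have "(\<Sum>i\<in>J. fscale (axis j 1 $ i) (\<eta> i)) = (\<Sum>i\<in>J. if i = j then \<eta> i else 0)"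
        by (intro sum.cong) (auto simp: axis_def)
      then show ?thesis using j by simp
    qed
    \<comment> \<open>The expansion of \<open>\<beta> j\<close> in the basis is itself a relation,
      hence \<gamma> satisfies it too.\<close>
    have "axis j 1 - v \<in> relation_space J \<beta>"
      using v j axis_in_coord_space [OF j] coord_space_mono [OF S(1)] ax [of \<beta>] vJ [of \<beta>]
      by (auto simp: relation_space_def fun_vs.scale_left_diff_distrib sum_subtractf
          intro!: vec.subspace_diff subspace_coord_space)
    then have "axis j 1 - v \<in> relation_space J \<gamma>" using rel by simp
    then have "\<gamma> j = (\<Sum>i\<in>S. fscale (v $ i) (\<gamma> i))"
      using ax [of \<gamma>] vJ [of \<gamma>]
      by (auto simp: relation_space_def fun_vs.scale_left_diff_distrib sum_subtractf)
    also have "\<dots> = f (\<beta> j)"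
      using S(2) fS by (simp add: v(2) fun_pair.linear_sum [OF f] fun_pair.linear_scale [OF f])
    finally show ?thesis by simp
  qed
  have "f ` fun_vs.span (\<beta> ` J) = fun_vs.span (\<gamma> ` J)"
  proof -
    have "f ` \<beta> ` J = \<gamma> ` J" using f\<beta> by force
    then show ?thesis using fun_pair.linear_span_image [OF f, of "\<beta> ` J"] by simp
  qed
  moreover have "inj_on f (fun_vs.span (\<beta> ` J))"
  proof -
    have "x = 0" if "x \<in> fun_vs.span (\<beta> ` J)" "f x = 0" for x
    proof -
      from that(1) obtain w where w: "w \<in> coord_space J" "x = (\<Sum>i\<in>J. fscale (w $ i) (\<beta> i))"
        unfolding span_image_sum by blast
      then have "f x = (\<Sum>i\<in>J. fscale (w $ i) (\<gamma> i))"
        using f\<beta> by (simp add: fun_pair.linear_sum [OF f] fun_pair.linear_scale [OF f])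
      then have "w \<in> relation_space J \<gamma>"
        using w that by (simp add: relation_space_def)
      then show ?thesis using rel w by (auto simp: relation_space_def)
    qed
    then show ?thesis
      using fun_pair.linear_inj_on_iff_eq_0 [OF f] by blast
  qed
  ultimately show "linearly_equivalent J \<beta> \<gamma>"
    unfolding linearly_equivalent_def bij_betw_def using f f\<beta> by blast
qed

section \<open>The rank of the resonance group\<close>

definition nat_cvec :: "nat^'n::finite \<Rightarrow> complex^'n" where
  "nat_cvec \<alpha> = (\<chi> j. of_nat (\<alpha> $ j))"

definition int_cvec :: "int^'n::finite \<Rightarrow> complex^'n" where
  "int_cvec m = (\<chi> j. of_int (m $ j))"

lemma int_cvec_simps [simp]:
  "int_cvec (x + y) = int_cvec x + int_cvec y" "int_cvec 0 = 0" "int_cvec (c *s x) = of_int c *s int_cvec x"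
  by (simp_all add: int_cvec_def vec_eq_iff)

lemma int_cvec_sum: "int_cvec (\<Sum>x\<in>A. f x) = (\<Sum>x\<in>A. int_cvec (f x))"
  by (induction A rule: infinite_finite_induct) simp_all

lemma inj_int_cvec: "inj int_cvec"
  by (auto simp: inj_def int_cvec_def vec_eq_iff)

lemma module_int_vec: "module ((*s) :: int \<Rightarrow> int^'n \<Rightarrow> int^'n)"
  by unfold_locales (auto simp: vec_eq_iff algebra_simps)

interpretation int_vec: module "(*s) :: int \<Rightarrow> int^'n::finite \<Rightarrow> int^'n"
  by (rule module_int_vec)

text \<open>Apply to the coefficients of a complex relation a rational-linear functional of \<open>\<complex>\<close> that does
  not vanish on a nonzero coefficient; clearing denominators leaves an integral relation.\<close>

lemma independent_int_cvec_image:
  fixes B :: "(int^'n::finite) set"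
  assumes "finite B" and indep: "\<not> int_vec.dependent B"
  shows "vec.independent (int_cvec ` B)"
proof (rule vec.independent_if_scalars_zero)
  interpret CQ: vector_space "\<lambda>q x :: complex. of_rat q * x"
    by unfold_locales (auto simp: algebra_simps of_rat_add of_rat_mult)
  interpret QQ: vector_space_pair "\<lambda>q x :: complex. of_rat q * x" "(*) :: rat \<Rightarrow> rat \<Rightarrow> rat"
    by unfold_locales (auto simp: algebra_simps)
  fix u v assume u: "(\<Sum>x\<in>int_cvec ` B. u x *s x) = 0" and v: "v \<in> int_cvec ` B"
  show "u v = 0"
  proof (rule ccontr)
    assume "u v \<noteq> 0"
    then have "CQ.independent {u v}"
      by (simp add: CQ.dependent_single)
    then obtain \<phi> where \<phi>: "Vector_Spaces.linear (\<lambda>q x :: complex. of_rat q * x) (*) \<phi>" "\<phi> (u v) = 1"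
      using QQ.linear_independent_extend [of "{u v}" "\<lambda>_. 1"] by auto
    have \<phi>_int: "\<phi> (x * of_int c) = \<phi> x * of_int c" for x c
      using QQ.linear_scale [OF \<phi>(1), of "of_int c" x] by (simp add: mult.commute)
    define q where "q b = \<phi> (u (int_cvec b))" for b
    have rel: "(\<Sum>b\<in>B. q b * of_int (b $ j)) = 0" for j
    proof -
      have "(\<Sum>b\<in>B. u (int_cvec b) * of_int (b $ j)) = (\<Sum>b\<in>B. u (int_cvec b) *s int_cvec b) $ j"
        by (simp add: int_cvec_def)
      also have "(\<Sum>b\<in>B. u (int_cvec b) *s int_cvec b) = 0"
        using u by (simp add: sum.reindex inj_on_subset [OF inj_int_cvec])
      finally have "\<phi> (\<Sum>b\<in>B. u (int_cvec b) * of_int (b $ j)) = 0"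
        by (simp add: QQ.linear_0 [OF \<phi>(1)])
      then show ?thesis
        by (simp add: QQ.linear_sum [OF \<phi>(1)] \<phi>_int q_def)
    qed
    define N where "N = (\<Prod>b\<in>B. snd (quotient_of (q b)))"
    have Npos: "N > 0"
      unfolding N_def by (intro prod_pos) (simp add: quotient_of_denom_pos')
    have "\<exists>z. of_int N * q b = of_int z" if b: "b \<in> B" for b
    proof -
      have "N = snd (quotient_of (q b)) * (\<Prod>b\<in>B - {b}. snd (quotient_of (q b)))"
        unfolding N_def using assms(1) b by (rule prod.remove)
      moreover have "of_int (snd (quotient_of (q b))) * q b = of_int (fst (quotient_of (q b)))"
      proof -
        obtain a c where "quotient_of (q b) = (a, c)" by fastforce
        with quotient_of_div [OF this] quotient_of_denom_pos [OF this] show ?thesis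
          by simp
      qed
      ultimately have "of_int N * q b =
          of_int (fst (quotient_of (q b)) * (\<Prod>b\<in>B - {b}. snd (quotient_of (q b))))"
        by (simp add: mult.commute mult.left_commute)
      then show ?thesis by blast
    qed
    then obtain z where z: "\<And>b. b \<in> B \<Longrightarrow> of_int N * q b = of_int (z b)" by metis
    have "(\<Sum>b\<in>B. z b *s b) = 0"
    proof -
      have "(\<Sum>b\<in>B. z b * b $ j) = 0" for j
      proof -
        have "(of_int (\<Sum>b\<in>B. z b * b $ j) :: rat) = (\<Sum>b\<in>B. of_int N * (q b * of_int (b $ j)))"
          using z by (simp flip: mult.assoc)
        also have "\<dots> = 0"
          by (simp add: rel flip: sum_distrib_left)
        finally show ?thesis by (simp only: of_int_eq_0_iff)
      qed
      then show ?thesis by (simp add: vec_eq_iff)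
    qed
    then have "z b = 0" if "b \<in> B" for b
      using int_vec.independentD [OF indep assms(1) order_refl _ that] by blast
    moreover obtain b where b: "b \<in> B" "v = int_cvec b" using v by blast
    ultimately have "of_int N * q b = 0"
      using z [OF b(1)] by simp
    moreover have "q b = 1"
      using b \<phi>(2) by (simp add: q_def)
    ultimately show False
      using Npos by simp
  qed
qed (use assms in auto)

text \<open>A complex basis of the span can be selected among the vectors of \<open>M\<close>. It is
  independent over the integers, as an integral relation is also a complex one, so the maximum
  reaches the dimension. By \<open>independent_int_cvec_image\<close> it cannot exceed it.\<close>

lemma group_rank_eq_dim:
  fixes M :: "(int^'n::finite) set"
  shows "group_rank M = vec.dim (vec.span (int_cvec ` M))"
proof -
  let ?\<B> = "{B. B \<subseteq> M \<and> finite B \<and> \<not> int_vec.dependent B}"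
  have le: "card B \<le> vec.dim (vec.span (int_cvec ` M))" if "B \<in> ?\<B>" for B
  proof -
    have "card (int_cvec ` B) \<le> vec.dim (int_cvec ` M)"
      using that by (intro vec.independent_card_le_dim independent_int_cvec_image) auto
    then show ?thesis
      by (simp add: card_image inj_on_subset [OF inj_int_cvec])
  qed
  obtain C where C: "C \<subseteq> int_cvec ` M" "vec.independent C" "int_cvec ` M \<subseteq> vec.span C"
    "card C = vec.dim (int_cvec ` M)"
    by (rule vec.basis_exists)
  obtain B where B: "B \<subseteq> M" "C = int_cvec ` B" "inj_on int_cvec B"
    using subset_image_inj [of C int_cvec M] C(1) by blast
  have finB: "finite B"
    using B C(2) vec.finiteI_independent finite_image_iff by blast
  have "\<not> int_vec.dependent B"
  proof
    assume "int_vec.dependent B"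
    then obtain u b where u: "(\<Sum>b\<in>B. u b *s b) = 0" "b \<in> B" "u b \<noteq> 0"
      using int_vec.dependent_finite [OF finB] by auto
    have "(\<Sum>b\<in>B. of_int (u b) *s int_cvec b) = 0"
      using arg_cong [OF u(1), of int_cvec] by (simp add: int_cvec_sum)
    then have "(\<Sum>x\<in>C. of_int (u (inv_into B int_cvec x)) *s x) = 0"
      using B by (simp add: sum.reindex)
    then have "(of_int (u (inv_into B int_cvec (int_cvec b))) :: complex) = 0"
      using vec.independentD [OF C(2) vec.finiteI_independent [OF C(2)] order_refl,
          of "\<lambda>x. of_int (u (inv_into B int_cvec x))" "int_cvec b"] u(2) B(2) by blast
    then show False using u B by simp
  qed
  then have B': "B \<in> ?\<B>" "card B = vec.dim (vec.span (int_cvec ` M))"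
    using B C finB by (auto simp: card_image)
  have sub: "card ` ?\<B> \<subseteq> {..vec.dim (vec.span (int_cvec ` M))}"
    by (rule image_subsetI) (unfold atMost_iff, erule le)
  show ?thesis
    unfolding group_rank_def
  proof (rule Max_eqI)
    show "finite (card ` ?\<B>)"
      using sub by (rule finite_subset) simp
    show "y \<le> vec.dim (vec.span (int_cvec ` M))" if "y \<in> card ` ?\<B>" for y
      using sub that by blast
    show "vec.dim (vec.span (int_cvec ` M)) \<in> card ` ?\<B>"
      using B'(1) by (simp only: B'(2) [symmetric] imageI)
  qed
qed

lemma envelope_dim_eq: "envelope_dim \<Lambda> I = vec.dim (resonance_space \<Lambda> I)"
  by (simp add: envelope_dim_def group_rank_eq_dim resonance_space_def int_cvec_def)

text \<open>The group consists of integral combinations of semigroup elements, which lie already in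
  the complex span of the semigroup. In this form R_I can be compared with relation spaces.\<close>

lemma resonance_space_eq:
  fixes \<Lambda> :: "'n::finite \<Rightarrow> complex^'k \<Rightarrow> complex"
  shows "resonance_space \<Lambda> I = vec.span (nat_cvec ` support_semigroup \<Lambda> I)"
proof -
  let ?S = "support_semigroup \<Lambda> I" and ?f = "\<lambda>\<alpha> :: nat^'n. \<chi> j. int (\<alpha> $ j)"
  have f: "int_cvec (?f \<alpha>) = nat_cvec \<alpha>" for \<alpha>
    by (simp add: int_cvec_def nat_cvec_def)
  have "int_cvec m \<in> vec.span (nat_cvec ` ?S)" if "m \<in> support_group \<Lambda> I" for m
    using that unfolding support_group_def
  proof (induction rule: int_vec.span_induct_alt)
    case base
    then show ?case by (simp add: vec.span_zero)
  next
    case (step c x y)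
    then show ?case
      by (auto simp: f intro!: vec.span_add vec.span_scale intro: vec.span_base)
  qed
  moreover have "nat_cvec \<alpha> \<in> int_cvec ` support_group \<Lambda> I" if "\<alpha> \<in> ?S" for \<alpha>
    using that by (auto simp: support_group_def intro!: image_eqI [of _ _ "?f \<alpha>"] int_vec.span_base
        simp flip: f)
  ultimately have "vec.span (int_cvec ` support_group \<Lambda> I) = vec.span (nat_cvec ` ?S)"
    by (intro vec.span_eq [THEN iffD2] conjI) (auto intro: vec.span_base)
  then show ?thesis
    by (simp add: resonance_space_def int_cvec_def)
qed

lemma resonance_semigroup_eq: "resonance_semigroup J \<beta> = {\<alpha>. nat_cvec \<alpha> \<in> relation_space J \<beta>}"
  by (auto simp: resonance_semigroup_def relation_space_def coord_space_def nat_cvec_def)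

section \<open>Residual configurations\<close>

lemma linear_eq_sum_axis:
  fixes g :: "complex^'n::finite \<Rightarrow> complex^'k"
  assumes g: "Vector_Spaces.linear (*s) (*s) g" and w: "w \<in> coord_space J"
  shows "g w = (\<Sum>j\<in>J. w $ j *s g (axis j 1))"
proof -
  have "g w = g (\<Sum>j\<in>UNIV. w $ j *s axis j 1)"
    by (simp add: basis_expansion)
  also have "\<dots> = (\<Sum>j\<in>UNIV. w $ j *s g (axis j 1))"
    by (simp add: vec.linear_sum [OF g] vec.linear_scale [OF g])
  also have "\<dots> = (\<Sum>j\<in>J. w $ j *s g (axis j 1))"
    using w by (intro sum.mono_neutral_right) (auto simp: coord_space_def)
  finally show ?thesis .
qed

text \<open>Behind the surjectivity of the parametrisation: the weights are the classes of the
  coordinate vectors in \<complex>^J / K, a space of dimension d \<le> k that fits into the dual of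
  \<complex>^k.\<close>

lemma configuration_with_relation_space_exists:
  fixes K :: "(complex^'n::finite) set"
  assumes K: "vec.subspace K" "K \<subseteq> coord_space J"
    and dim: "vec.dim K + d = card J" and d: "d \<le> CARD('k)"
  obtains \<beta> :: "'n \<Rightarrow> complex^'k \<Rightarrow> complex" where "relation_space J \<beta> = K"
proof -
  obtain B where B: "B \<subseteq> K" "vec.independent B" "K \<subseteq> vec.span B" "card B = vec.dim K"
    by (rule vec.basis_exists)
  obtain B' where B': "B \<subseteq> B'" "B' \<subseteq> coord_space J" "vec.independent B'" "coord_space J \<subseteq> vec.span B'"
    using vec.maximal_independent_subset_extend [of B "coord_space J"] B K by blast
  have fin: "finite B'" using B'(3) by (rule vec.finiteI_independent)
  have finB: "finite B" using B'(1) fin by (rule finite_subset)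
  have "card B' = card J"
    using vec.basis_card_eq_dim [OF B'(2,4,3)] by (simp add: dim_coord_space)
  then have "card (B' - B) = d"
    using B'(1) dim B(4) finB by (simp add: card_Diff_subset)
  \<comment> \<open>The d basis vectors outside K get distinct coordinates of \<complex>^k; this is
    where \<open>d \<le> CARD('k)\<close> enters.\<close>
  then obtain \<iota> :: "complex^'n \<Rightarrow> 'k" where \<iota>: "inj_on \<iota> (B' - B)"
    using card_le_inj [of "B' - B" "UNIV :: 'k set"] d fin by auto
  obtain g :: "complex^'n \<Rightarrow> complex^'k" where g: "Vector_Spaces.linear (*s) (*s) g"
    and gB': "\<And>x. x \<in> B' \<Longrightarrow> g x = (if x \<in> B then 0 else axis (\<iota> x) 1)"
    using vec.linear_independent_extend [OF B'(3), of "\<lambda>x. if x \<in> B then 0 else axis (\<iota> x) 1"]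
    by blast
  have gK: "g w = 0 \<longleftrightarrow> w \<in> K" if w: "w \<in> coord_space J" for w
  proof
    assume "w \<in> K"
    then obtain u where "w = (\<Sum>x\<in>B. u x *s x)"
      using B(3) vec.span_finite [OF finB] by blast
    then show "g w = 0"
      using gB' B'(1) by (auto simp: vec.linear_sum [OF g] vec.linear_scale [OF g] intro!: sum.neutral)
  next
    assume gw: "g w = 0"
    obtain u where u: "w = (\<Sum>x\<in>B'. u x *s x)"
      using w B'(4) vec.span_finite [OF fin] by blast
    have "u y = 0" if y: "y \<in> B' - B" for y
    proof -
      have "0 = g w $ \<iota> y" by (simp add: gw)
      also have "\<dots> = (\<Sum>x\<in>B'. u x * g x $ \<iota> y)"
        by (simp add: u vec.linear_sum [OF g] vec.linear_scale [OF g])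
      also have "\<dots> = (\<Sum>x\<in>B'. if x = y then u x else 0)"
        using y \<iota> by (intro sum.cong) (auto simp: gB' axis_def dest: inj_onD)
      also have "\<dots> = u y" using y fin by simp
      finally show ?thesis by simp
    qed
    then have "w = (\<Sum>x\<in>B. u x *s x)"
      unfolding u using B'(1) fin by (intro sum.mono_neutral_right) auto
    then show "w \<in> K"
      using B(1) K(1) by (auto intro!: vec.subspace_sum vec.subspace_scale)
  qed
  \<comment> \<open>The coordinate pairing of \<complex>^k turns the vectors
    \<open>g (axis j 1)\<close> into covectors; it is injective, so no relations are added.\<close>
  define \<beta> :: "'n \<Rightarrow> complex^'k \<Rightarrow> complex" where "\<beta> j = (\<lambda>t. \<Sum>i\<in>UNIV. g (axis j 1) $ i * t $ i)" for j
  have "(\<Sum>j\<in>J. fscale (w $ j) (\<beta> j)) t = (\<Sum>i\<in>UNIV. g w $ i * t $ i)"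
    if "w \<in> coord_space J" for w t
    unfolding linear_eq_sum_axis [OF g that] \<beta>_def sum_fun_apply fscale_apply
    by (simp add: sum_distrib_left sum_distrib_right mult.assoc) (rule sum.swap)
  moreover have "(\<forall>t. (\<Sum>i\<in>UNIV. v $ i * t $ i) = 0) \<longleftrightarrow> v = 0" for v :: "complex^'k"
  proof
    assume *: "\<forall>t. (\<Sum>i\<in>UNIV. v $ i * t $ i) = 0"
    have "v $ i = 0" for i
      using * [rule_format, of "axis i 1"] by (simp add: axis_def if_distrib cong: if_cong)
    then show "v = 0" by (simp add: vec_eq_iff)
  qed simp
  ultimately have "(\<Sum>j\<in>J. fscale (w $ j) (\<beta> j)) = 0 \<longleftrightarrow> g w = 0" if "w \<in> coord_space J" for w
    using that by (simp add: fun_eq_iff)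
  then have "relation_space J \<beta> = K"
    using gK K(2) by (auto simp: relation_space_def)
  then show thesis by (rule that)
qed

text \<open>Otherwise some \<open>\<beta> j\<close> could be adjoined to a basis chosen from
  \<open>T\<close>, and the rank over \<open>J\<close> would exceed the rank over
  \<open>T\<close>.\<close>

lemma image_subset_span_if_weight_rank_eq:
  fixes \<beta> :: "'n::finite \<Rightarrow> complex^'k \<Rightarrow> complex"
  assumes "T \<subseteq> J" and rank: "weight_rank \<beta> T = weight_rank \<beta> J"
  shows "\<beta> ` J \<subseteq> fun_vs.span (\<beta> ` T)"
proof (rule subsetI, rule ccontr)
  fix x assume "x \<in> \<beta> ` J" and x: "x \<notin> fun_vs.span (\<beta> ` T)"
  then obtain j where j: "j \<in> J" "x = \<beta> j" by blast
  obtain S where S: "S \<subseteq> T" "inj_on \<beta> S" "fun_vs.independent (\<beta> ` S)"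
    "\<beta> ` T \<subseteq> fun_vs.span (\<beta> ` S)" "card S = fun_vs.dim (\<beta> ` T)"
    by (rule basis_labels_exist)
  have notin: "\<beta> j \<notin> fun_vs.span (\<beta> ` S)"
    using x j(2) fun_vs.span_mono [OF image_mono [OF S(1)]] by blast
  then have "\<beta> j \<notin> \<beta> ` S"
    using fun_vs.span_base [of "\<beta> j" "\<beta> ` S"] by blast
  moreover have "fun_vs.independent (\<beta> ` insert j S)"
    using fun_vs.independent_insertI [OF notin S(3)] by simp
  ultimately have "relation_space (insert j S) \<beta> = {0}"
    unfolding relation_space_trivial_iff using S(2) by auto
  then have "weight_rank \<beta> (insert j S) = card (insert j S)"
    by (simp add: weight_rank_eq_card_iff)
  moreover have "j \<notin> S" using \<open>\<beta> j \<notin> \<beta> ` S\<close> by blast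
  moreover have "weight_rank \<beta> (insert j S) \<le> weight_rank \<beta> J"
    using assms(1) j S(1) by (intro weight_rank_mono) auto
  ultimately show False
    using S(5) rank by (simp add: weight_rank_def)
qed

text \<open>The coordinate functionals are a basis. The count turns the spanning condition of
  \<open>weight_configuration\<close> into a rank.\<close>

lemma dim_dual_space: "fun_vs.dim (dual_space :: (complex^'k \<Rightarrow> complex) set) = CARD('k)"
proof -
  define c :: "'k \<Rightarrow> complex^'k \<Rightarrow> complex" where "c i = (\<lambda>t. t $ i)" for i
  have sum_c: "(\<Sum>i\<in>UNIV. fscale (w $ i) (c i)) = (\<lambda>t. \<Sum>i\<in>UNIV. w $ i * t $ i)" for w :: "complex^'k"
    by (auto simp: fun_eq_iff sum_fun_apply fscale_apply c_def)
  have "relation_space UNIV c = {0}"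
  proof -
    have "w = 0" if "w \<in> relation_space UNIV c" for w
    proof -
      have "(\<Sum>i\<in>UNIV. w $ i * t $ i) = 0" for t
        using that fun_cong [OF sum_c [of w], of t] by (simp add: relation_space_def)
      from this [of "axis _ 1"] have "w $ i = 0" for i
        by (simp add: axis_def if_distrib cong: if_cong)
      then show ?thesis by (simp add: vec_eq_iff)
    qed
    then show ?thesis
      using vec.subspace_0 [OF subspace_relation_space] by blast
  qed
  then have c: "inj c" "fun_vs.independent (range c)"
    by (simp_all add: relation_space_trivial_iff)
  have "fun_vs.span (range c) = dual_space"
  proof
    show "fun_vs.span (range c) \<subseteq> dual_space"
    proof -
      have "Vector_Spaces.linear (*s) (*) (\<lambda>t. \<Sum>i\<in>UNIV. w $ i * t $ i)" for w :: "complex^'k"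
        by unfold_locales (simp_all add: algebra_simps sum.distrib sum_distrib_left)
      then show ?thesis
        unfolding span_image_sum sum_c dual_space_def by blast
    qed
    show "dual_space \<subseteq> fun_vs.span (range c)"
    proof
      fix f :: "complex^'k \<Rightarrow> complex" assume "f \<in> dual_space"
      then interpret f: Vector_Spaces.linear "(*s)" "(*)" f
        by (simp add: dual_space_def)
      have "f t = (\<Sum>i\<in>UNIV. f (axis i 1) * t $ i)" for t
      proof -
        have "f t = f (\<Sum>i\<in>UNIV. t $ i *s axis i 1)" by (simp add: basis_expansion)
        also have "\<dots> = (\<Sum>i\<in>UNIV. f (axis i 1) * t $ i)"
          by (simp only: f.sum f.scale) (simp add: mult.commute)
        finally show ?thesis .
      qed
      then have "f = (\<lambda>t. \<Sum>i\<in>UNIV. (\<chi> i. f (axis i 1)) $ i * t $ i)"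
        unfolding vec_lambda_beta by (rule ext)
      then have "f = (\<Sum>i\<in>UNIV. fscale ((\<chi> i. f (axis i 1)) $ i) (c i))"
        by (simp only: sum_c)
      then show "f \<in> fun_vs.span (range c)"
        unfolding span_image_sum by (rule image_eqI) (simp add: coord_space_def)
    qed
  qed
  then show ?thesis
    using fun_vs.dim_span_eq_card_independent [OF c(2)] c(1) by (simp add: card_image)
qed

text \<open>Brings the exclusion of a single resonance into the form shared by all conditions,
  trivial intersection with a subspace.\<close>

lemma subspace_Int_span_singleton:
  assumes "vec.subspace K" and "v \<noteq> (0 :: complex^'n::finite)"
  shows "K \<inter> vec.span {v} = {0} \<longleftrightarrow> v \<notin> K"
proof
  assume "K \<inter> vec.span {v} = {0}"
  then show "v \<notin> K" using assms(2) vec.span_base [of v "{v}"] by blast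
next
  assume v: "v \<notin> K"
  have "x = 0" if "x \<in> K" "x \<in> vec.span {v}" for x
  proof -
    obtain c where x: "x = c *s v" using \<open>x \<in> vec.span {v}\<close> vec.span_singleton [of v] by blast
    have "c = 0"
    proof (rule ccontr)
      assume "c \<noteq> 0"
      then have "v = inverse c *s x" using x by simp
      then show False using v vec.subspace_scale [OF assms(1) \<open>x \<in> K\<close>] by blast
    qed
    then show ?thesis using x by simp
  qed
  then show "K \<inter> vec.span {v} = {0}"
    using vec.subspace_0 [OF assms(1)] vec.span_zero by blast
qed

section \<open>A weight configuration of uniform maximal rank with a singular support\<close>

locale uniform_configuration =
  fixes \<Lambda> :: "'n::finite \<Rightarrow> complex^'k \<Rightarrow> complex" and I :: "'n set"
  assumes config: "weight_configuration \<Lambda>"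
    and uniform: "uniform_maximal_rank UNIV CARD('k) \<Lambda>"
    and singular: "singular_support \<Lambda> I"
begin

lemma weight_rank_UNIV: "weight_rank \<Lambda> UNIV = CARD('k)"
proof -
  have "weight_rank \<Lambda> UNIV = fun_vs.dim (fun_vs.span (range \<Lambda>))"
    by (simp add: weight_rank_def)
  also have "\<dots> = CARD('k)"
    using config by (simp only: weight_configuration_def dim_dual_space)
  finally show ?thesis .
qed

lemma card_le: "CARD('k) \<le> CARD('n)"
  using weight_rank_plus_dim_relation_space [of \<Lambda> UNIV] by (simp add: weight_rank_UNIV)

lemma card_I: "card I < CARD('k)"
  using singular uniform by (auto simp: singular_support_def uniform_maximal_rank_def min_def split: if_splits)

lemma residual_dim: "card I + residual_dim \<Lambda> I = CARD('k)"
  using card_I by (simp add: residual_dim_def)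

lemma card_compl_support: "card (- I) = (CARD('n) - CARD('k)) + residual_dim \<Lambda> I"
  using card_le residual_dim card_Diff_subset [of I UNIV] card_mono [of UNIV I]
  by (simp add: Compl_eq_Diff_UNIV)

lemma relation_space_\<Lambda>: "card T = CARD('k) \<Longrightarrow> relation_space T \<Lambda> = {0}"
  using uniform uniform_maximal_rank_iff [OF weight_rank_UNIV] by blast

lemma \<Lambda>_in_span:
  assumes "card T = CARD('k)"
  shows "\<Lambda> j \<in> fun_vs.span (\<Lambda> ` T)"
  using image_subset_span_if_weight_rank_eq [of T UNIV \<Lambda>] relation_space_\<Lambda> [OF assms] assms
  by (auto simp: weight_rank_UNIV simp flip: weight_rank_eq_card_iff)

lemma linear_\<Lambda>: "Vector_Spaces.linear (*s) (*) (\<Lambda> j)"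
  using config by (auto simp: weight_configuration_def dual_space_def)

text \<open>Evaluating k of the weights is an isomorphism from \<complex>^k onto \<complex>^T: they
  span the dual space, so a common zero of them is a zero of every covector, in particular of the
  coordinates, and the dimensions agree.\<close>

lemma dual_basis:
  assumes T: "card T = CARD('k)" and j: "j \<in> T"
  obtains t where "\<And>i. i \<in> T \<Longrightarrow> \<Lambda> i t = (if i = j then 1 else 0)"
proof -
  define e :: "complex^'k \<Rightarrow> complex^'n" where "e t = (\<chi> i. if i \<in> T then \<Lambda> i t else 0)" for t
  interpret \<Lambda>: Vector_Spaces.linear "(*s)" "(*)" "\<Lambda> i" for i
    by (rule linear_\<Lambda>)
  have e: "Vector_Spaces.linear (*s) (*s) e"
    by unfold_locales (auto simp: e_def vec_eq_iff \<Lambda>.add \<Lambda>.scale)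
  have "t = 0" if "e t = 0" for t
  proof -
    have T0: "\<Lambda> i t = 0" if "i \<in> T" for i
      using arg_cong [OF \<open>e t = 0\<close>, of "\<lambda>x. x $ i"] that by (simp add: e_def)
    have "fun_vs.subspace {f. f t = 0}"
      by (auto simp: fun_vs.subspace_def fscale_apply)
    moreover have "\<Lambda> ` T \<subseteq> {f. f t = 0}" using T0 by blast
    ultimately have "fun_vs.span (\<Lambda> ` T) \<subseteq> {f. f t = 0}"
      by (metis fun_vs.span_minimal)
    then have "range \<Lambda> \<subseteq> {f. f t = 0}" using \<Lambda>_in_span [OF T] by blast
    then have "dual_space \<subseteq> {f. f t = 0}"
      using fun_vs.span_minimal \<open>fun_vs.subspace {f. f t = 0}\<close> config
      unfolding weight_configuration_def by blast
    moreover have "(\<lambda>t. t $ i) \<in> (dual_space :: (complex^'k \<Rightarrow> complex) set)" for i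
      unfolding dual_space_def by (rule CollectI) (unfold_locales, simp_all)
    ultimately show ?thesis by (auto simp: vec_eq_iff)
  qed
  then have inj: "inj e" using vec.linear_inj_iff_eq_0 [OF e] by blast
  have "range e = coord_space T"
  proof (rule vec.subspace_dim_equal)
    show "vec.subspace (range e)"
      using vec.linear_subspace_image [OF e vec.subspace_UNIV] .
    show "range e \<subseteq> coord_space T" by (auto simp: e_def coord_space_def)
    show "vec.dim (coord_space T) \<le> vec.dim (range e)"
      using vec.dim_image_eq [OF e, of UNIV] inj T by (simp add: dim_coord_space card_cart_basis)
  qed (rule subspace_coord_space)
  then obtain t where "axis j 1 = e t"
    using axis_in_coord_space [OF j] by blast
  then have "\<Lambda> i t = (if i = j then 1 else 0)" if "i \<in> T" for i
    using that by (auto simp: e_def vec_eq_iff axis_def split: if_splits)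
  then show thesis by (rule that)
qed

text \<open>Together \<open>T\<close> and \<open>I\<close> label k weights. The point dual to a
  label j in \<open>T\<close> is killed by the weights in \<open>I\<close>, so it lies in the
  isotropy space, and evaluating a relation there isolates its j-th coefficient.\<close>

lemma relation_space_residual_weight:
  assumes T: "T \<subseteq> - I" "card T = residual_dim \<Lambda> I"
  shows "relation_space T (residual_weight \<Lambda> I) = {0}"
proof -
  have card: "card (T \<union> I) = CARD('k)"
    using T residual_dim card_Un_disjoint [of T I] by force
  have *: "w $ j = 0" if w: "w \<in> relation_space T (residual_weight \<Lambda> I)" and j: "j \<in> T" for w j
  proof -
    obtain t where t: "\<And>i. i \<in> T \<union> I \<Longrightarrow> \<Lambda> i t = (if i = j then 1 else 0)"
      using dual_basis [OF card, of j] j by blast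
    have "t \<in> isotropy \<Lambda> I"
      using t T(1) j by (auto simp: isotropy_def)
    then have "(\<Sum>i\<in>T. fscale (w $ i) (residual_weight \<Lambda> I i)) t = (\<Sum>i\<in>T. if i = j then w $ i else 0)"
      unfolding sum_fun_apply using t by (intro sum.cong) (auto simp: fscale_apply residual_weight_def)
    then show ?thesis
      using w j by (simp add: relation_space_def)
  qed
  then have "w = 0" if "w \<in> relation_space T (residual_weight \<Lambda> I)" for w
  proof -
    have "w $ j = 0" for j
      using that * [OF that] by (cases "j \<in> T") (auto simp: relation_space_def coord_space_def)
    then show ?thesis by (simp add: vec_eq_iff)
  qed
  then show ?thesis
    using vec.subspace_0 [OF subspace_relation_space] by blast
qed

text \<open>Every weight is a combination of those labelled by \<open>T\<close> and
  \<open>I\<close>, and on the isotropy space the terms from \<open>I\<close> drop out. So the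
  residual weights over \<open>T\<close> span; they are independent by
  \<open>relation_space_residual_weight\<close>.\<close>

lemma weight_rank_residual_weight: "weight_rank (residual_weight \<Lambda> I) (- I) = residual_dim \<Lambda> I"
proof -
  obtain T where T: "T \<subseteq> - I" "card T = residual_dim \<Lambda> I"
    using obtain_subset_with_card_n [of "residual_dim \<Lambda> I" "- I"] card_compl_support by auto
  have card: "card (T \<union> I) = CARD('k)"
    using T residual_dim card_Un_disjoint [of T I] by force
  have "residual_weight \<Lambda> I j \<in> fun_vs.span (residual_weight \<Lambda> I ` T)" if "j \<in> - I" for j
  proof -
    obtain v where v: "\<Lambda> j = (\<Sum>i\<in>T \<union> I. fscale (v $ i) (\<Lambda> i))"
      using \<Lambda>_in_span [OF card, of j] unfolding span_image_sum by blast
    have "residual_weight \<Lambda> I j t = (\<Sum>i\<in>T. fscale (v $ i) (residual_weight \<Lambda> I i)) t" for t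
    proof (cases "t \<in> isotropy \<Lambda> I")
      case True
      then have "residual_weight \<Lambda> I j t = (\<Sum>i\<in>T \<union> I. v $ i * \<Lambda> i t)"
        by (simp add: residual_weight_def v sum_fun_apply fscale_apply)
      also have "\<dots> = (\<Sum>i\<in>T. v $ i * \<Lambda> i t)"
        using True by (intro sum.mono_neutral_right) (auto simp: isotropy_def)
      finally show ?thesis
        using True by (simp add: residual_weight_def sum_fun_apply fscale_apply)
    qed (simp add: residual_weight_def sum_fun_apply fscale_apply)
    then have "residual_weight \<Lambda> I j = (\<Sum>i\<in>T. fscale (v $ i) (residual_weight \<Lambda> I i))"
      by blast
    then show ?thesis
      by (auto intro!: fun_vs.span_sum fun_vs.span_scale intro: fun_vs.span_base)
  qed
  then have "weight_rank (residual_weight \<Lambda> I) (- I) \<le> card (residual_weight \<Lambda> I ` T)"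
    unfolding weight_rank_def by (intro fun_vs.dim_le_card) auto
  also have "\<dots> \<le> residual_dim \<Lambda> I"
    using card_image_le [of T "residual_weight \<Lambda> I"] T(2) by simp
  finally show ?thesis
    using weight_rank_mono [OF T(1), of "residual_weight \<Lambda> I"] T(2)
      weight_rank_eq_card_iff [of "residual_weight \<Lambda> I" T] relation_space_residual_weight [OF T]
    by simp
qed

lemma residual_weight_in_same_envelope_configs:
  "residual_weight \<Lambda> I \<in> same_envelope_configs \<Lambda> I"
  using relation_space_residual_weight weight_rank_residual_weight
  by (auto simp: same_envelope_configs_def residual_configuration_def uniform_maximal_rank_iff
      support_semigroup_def)

lemma subspace_resonance_space: "vec.subspace (resonance_space \<Lambda> I)"
  by (simp add: resonance_space_def)

lemma resonance_space_subset:
  assumes "resonance_semigroup (- I) \<beta> = support_semigroup \<Lambda> I"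
  shows "resonance_space \<Lambda> I \<subseteq> relation_space (- I) \<beta>"
  unfolding resonance_space_eq assms [symmetric] resonance_semigroup_eq
  by (intro vec.span_minimal subspace_relation_space) auto

lemma dim_relation_space:
  assumes "weight_rank \<beta> (- I) = residual_dim \<Lambda> I"
  shows "vec.dim (relation_space (- I) \<beta>) = CARD('n) - CARD('k)"
  using weight_rank_plus_dim_relation_space [of \<beta> "- I"] assms card_compl_support by simp

text \<open>The truncated subtraction in \<open>defect\<close> loses nothing, because the resonance
  space lies in the relation space of the residual weights, whose dimension is n - k.\<close>

lemma dim_resonance_space_plus_defect:
  "vec.dim (resonance_space \<Lambda> I) + defect \<Lambda> I = CARD('n) - CARD('k)"
proof -
  have "vec.dim (resonance_space \<Lambda> I) \<le> vec.dim (relation_space (- I) (residual_weight \<Lambda> I))"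
    by (intro vec.dim_subset resonance_space_subset) (simp add: support_semigroup_def)
  then show ?thesis
    by (simp add: dim_relation_space weight_rank_residual_weight defect_def envelope_dim_eq)
qed

text \<open>Both uniform maximal rank and the absence of further resonances say that the relation space
  meets each subspace of the following countable family trivially.\<close>

definition avoided :: "(complex^'n) set set" where
  "avoided = coord_space ` {T. T \<subseteq> - I \<and> card T = residual_dim \<Lambda> I} \<union>
     (\<lambda>\<alpha>. vec.span {nat_cvec \<alpha>}) ` {\<alpha>. nat_cvec \<alpha> \<in> coord_space (- I) \<and> \<alpha> \<notin> support_semigroup \<Lambda> I}"

lemma countable_avoided: "countable avoided"
  unfolding avoided_def by (intro countable_Un countable_image countableI_type)

lemma avoided_subspace:
  assumes "C \<in> avoided"
  shows "vec.subspace C" "C \<subseteq> coord_space (- I)"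
proof -
  have "coord_space T \<subseteq> coord_space (- I)" if "T \<subseteq> - I" for T
    using that by (rule coord_space_mono)
  moreover have "vec.span {nat_cvec \<alpha>} \<subseteq> coord_space (- I)" if "nat_cvec \<alpha> \<in> coord_space (- I)" for \<alpha>
    using that by (intro vec.span_minimal subspace_coord_space) simp
  ultimately show "vec.subspace C" "C \<subseteq> coord_space (- I)"
    using assms by (auto simp: avoided_def subspace_coord_space)
qed

text \<open>The dimension encodes the rank, by rank-nullity. The inclusion supplies the resonances
  in S_I, the lines in \<open>avoided\<close> exclude all others, and the coordinate subspaces give
  uniform maximal rank.\<close>

lemma mem_same_envelope_configs_iff:
  "\<beta> \<in> same_envelope_configs \<Lambda> I \<longleftrightarrow>
     resonance_space \<Lambda> I \<subseteq> relation_space (- I) \<beta> \<and>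
     vec.dim (relation_space (- I) \<beta>) = vec.dim (resonance_space \<Lambda> I) + defect \<Lambda> I \<and>
     (\<forall>C\<in>avoided. relation_space (- I) \<beta> \<inter> C = {0})"
  (is "_ \<longleftrightarrow> ?R \<subseteq> ?K \<and> ?dim \<and> ?avoid")
proof -
  have rank: "residual_configuration (- I) (residual_dim \<Lambda> I) \<beta> \<longleftrightarrow> ?dim"
    using weight_rank_plus_dim_relation_space [of \<beta> "- I"] card_compl_support
      dim_resonance_space_plus_defect
    by (auto simp: residual_configuration_def)
  have umr: "uniform_maximal_rank (- I) (residual_dim \<Lambda> I) \<beta> \<longleftrightarrow>
      (\<forall>T. T \<subseteq> - I \<and> card T = residual_dim \<Lambda> I \<longrightarrow> ?K \<inter> coord_space T = {0})"
    if "residual_configuration (- I) (residual_dim \<Lambda> I) \<beta>"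
    using that by (auto simp: residual_configuration_def uniform_maximal_rank_iff relation_space_Int_coord_space)
  \<comment> \<open>As 0 is a resonance, each \<alpha> outside the semigroup is nonzero and spans an
    actual line.\<close>
  have zero: "(0 :: nat^'n) \<in> support_semigroup \<Lambda> I"
    by (simp add: support_semigroup_def resonance_semigroup_def)
  have nat0: "nat_cvec \<alpha> = 0 \<longleftrightarrow> \<alpha> = 0" for \<alpha> :: "nat^'n"
    by (simp add: nat_cvec_def vec_eq_iff)
  have span: "?K \<inter> vec.span {nat_cvec \<alpha>} = {0} \<longleftrightarrow> nat_cvec \<alpha> \<notin> ?K"
    if "\<alpha> \<notin> support_semigroup \<Lambda> I" for \<alpha>
    using that zero nat0 by (intro subspace_Int_span_singleton subspace_relation_space) auto
  have sub: "?R \<subseteq> ?K \<longleftrightarrow> (\<forall>\<alpha>\<in>support_semigroup \<Lambda> I. nat_cvec \<alpha> \<in> ?K)"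
  proof
    assume "?R \<subseteq> ?K"
    then show "\<forall>\<alpha>\<in>support_semigroup \<Lambda> I. nat_cvec \<alpha> \<in> ?K"
      unfolding resonance_space_eq by (blast intro: vec.span_base)
  next
    assume "\<forall>\<alpha>\<in>support_semigroup \<Lambda> I. nat_cvec \<alpha> \<in> ?K"
    then show "?R \<subseteq> ?K"
      unfolding resonance_space_eq by (intro vec.span_minimal subspace_relation_space) auto
  qed
  have "resonance_semigroup (- I) \<beta> = support_semigroup \<Lambda> I \<longleftrightarrow>
     ?R \<subseteq> ?K \<and> (\<forall>\<alpha>. nat_cvec \<alpha> \<in> coord_space (- I) \<and> \<alpha> \<notin> support_semigroup \<Lambda> I \<longrightarrow>
        ?K \<inter> vec.span {nat_cvec \<alpha>} = {0})"
    unfolding sub resonance_semigroup_eq set_eq_iff [of "Collect _"]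
    using span relation_space_subset [of "- I" \<beta>] by blast
  then show ?thesis
    using rank umr by (auto simp: same_envelope_configs_def avoided_def ball_Un)
qed

end

text \<open>Bilinear, without conjugation: vectors stand for linear functionals, and everything
  built from the pairing stays polynomial in the entries.\<close>

definition cdot :: "complex^'n::finite \<Rightarrow> complex^'n \<Rightarrow> complex" where
  "cdot \<gamma> x = (\<Sum>q\<in>UNIV. \<gamma> $ q * x $ q)"

lemma cdot_add: "cdot \<gamma> (x + y) = cdot \<gamma> x + cdot \<gamma> y"
  by (simp add: cdot_def algebra_simps sum.distrib)

lemma cdot_diff: "cdot \<gamma> (x - y) = cdot \<gamma> x - cdot \<gamma> y"
  by (simp add: cdot_def algebra_simps sum_subtractf)

lemma cdot_scale: "cdot \<gamma> (c *s x) = c * cdot \<gamma> x"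
  by (simp add: cdot_def algebra_simps sum_distrib_left)

lemma cdot_zero: "cdot \<gamma> 0 = 0"
  by (simp add: cdot_def)

lemma cdot_sum: "cdot \<gamma> (\<Sum>i\<in>A. f i) = (\<Sum>i\<in>A. cdot \<gamma> (f i))"
  by (induction A rule: infinite_finite_induct) (simp_all add: cdot_add cdot_zero)

lemmas cdot_simps = cdot_add cdot_diff cdot_scale cdot_zero cdot_sum

section \<open>Frames\<close>

lemma span_family:
  fixes F :: "nat \<Rightarrow> complex^'n::finite"
  shows "vec.span (F ` {..<m}) = range (\<lambda>a. \<Sum>i<m. a i *s F i)"
proof
  let ?L = "\<lambda>a. \<Sum>i<m. a i *s F i"
  have "F j \<in> range ?L" if "j < m" for j
  proof
    have "?L (\<lambda>i. if i = j then 1 else 0) = (\<Sum>i<m. if i = j then F i else 0)"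
      by (intro sum.cong) auto
    then show "F j = ?L (\<lambda>i. if i = j then 1 else 0)" using that by simp
  qed auto
  moreover have "vec.subspace (range ?L)"
  proof (rule vec.subspaceI)
    show "0 \<in> range ?L" by (rule image_eqI [of _ _ "\<lambda>_. 0"]) auto
    fix x y c assume "x \<in> range ?L"
    then obtain a where a: "x = ?L a" by blast
    show "c *s x \<in> range ?L"
      by (rule image_eqI [of _ _ "\<lambda>i. c * a i"]) (simp_all add: a vec.scale_sum_right)
    assume "y \<in> range ?L"
    then obtain b where b: "y = ?L b" by blast
    show "x + y \<in> range ?L"
      by (rule image_eqI [of _ _ "\<lambda>i. a i + b i"]) (simp_all add: a b vec.scale_left_distrib sum.distrib)
  qed
  ultimately show "vec.span (F ` {..<m}) \<subseteq> range ?L"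
    by (intro vec.span_minimal) auto
  show "range ?L \<subseteq> vec.span (F ` {..<m})"
    by (auto intro!: vec.span_sum vec.span_scale intro: vec.span_base)
qed

lemma Union_quotient_image: "\<Union> (quotient_image R K) = {x + y |x y. x \<in> K \<and> y \<in> R}"
  by (auto simp: quotient_image_def)

text \<open>A point K/R is a set of cosets, and their union gives K back; this inverts the passage
  from K to K/R.\<close>

lemma Union_quotient_image_subspace:
  assumes "vec.subspace K" "vec.subspace R" "R \<subseteq> K"
  shows "\<Union> (quotient_image R K) = K"
proof
  show "\<Union> (quotient_image R K) \<subseteq> K"
    using assms vec.subspace_add [OF assms(1)] by (auto simp: Union_quotient_image)
  show "K \<subseteq> \<Union> (quotient_image R K)"
  proof
    fix x assume "x \<in> K"
    then have "x + 0 \<in> \<Union> (quotient_image R K)"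
      using vec.subspace_0 [OF assms(2)] unfolding Union_quotient_image by blast
    then show "x \<in> \<Union> (quotient_image R K)" by simp
  qed
qed

text \<open>The subspace K of V for which K/R is the point \<open>frame_span R m F\<close>.
  Dimensions and intersections are computed with it instead of with cosets.\<close>

definition frame_sum :: "(complex^'n::finite) set \<Rightarrow> nat \<Rightarrow> (nat \<Rightarrow> complex^'n) \<Rightarrow> (complex^'n) set" where
  "frame_sum R m F = {x + y |x y. x \<in> vec.span (F ` {..<m}) \<and> y \<in> R}"

lemma Union_frame_span: "\<Union> (frame_span R m F) = frame_sum R m F"
  by (simp add: frame_span_def frame_sum_def Union_quotient_image)

lemma mem_frame_sum: "x \<in> frame_sum R m F \<longleftrightarrow> (\<exists>a. \<exists>r\<in>R. x = (\<Sum>i<m. a i *s F i) + r)"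
  by (auto simp: frame_sum_def span_family)

lemma sum_in_frame_sum:
  assumes "vec.subspace R"
  shows "(\<Sum>i<m. a i *s F i) \<in> frame_sum R m F"
  unfolding mem_frame_sum using vec.subspace_0 [OF assms] add_0_right by metis

lemma subspace_frame_sum: "vec.subspace R \<Longrightarrow> vec.subspace (frame_sum R m F)"
  unfolding frame_sum_def by (intro vec.subspace_sums vec.subspace_span)

lemma frame_sum_subset:
  assumes "vec.subspace V" "R \<subseteq> V" "\<And>i. i < m \<Longrightarrow> F i \<in> V"
  shows "frame_sum R m F \<subseteq> V"
  using assms by (auto simp: mem_frame_sum intro!: vec.subspace_add vec.subspace_sum vec.subspace_scale)

lemma subset_frame_sum: "R \<subseteq> frame_sum R m F"
  by (auto simp: mem_frame_sum intro!: exI [of _ "\<lambda>_. 0"])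

lemma frame_in_frame_sum:
  assumes "vec.subspace R" "i < m"
  shows "F i \<in> frame_sum R m F"
  using assms vec.subspace_0 [OF assms(1)] vec.span_base [of "F i" "F ` {..<m}"]
  by (force simp: frame_sum_def)

lemma quotient_framesD:
  assumes "F \<in> quotient_frames V R m"
  shows "\<And>i. i < m \<Longrightarrow> F i \<in> V" "\<And>a i. (\<Sum>i<m. a i *s F i) \<in> R \<Longrightarrow> i < m \<Longrightarrow> a i = 0"
    "F \<in> {..<m} \<rightarrow>\<^sub>E V"
  using assms by (auto simp: quotient_frames_def)

lemma quotient_frames_inj_on:
  assumes "vec.subspace R" "F \<in> quotient_frames V R m"
  shows "inj_on F {..<m}"
proof (rule inj_onI, rule ccontr)
  fix i j assume ij: "i \<in> {..<m}" "j \<in> {..<m}" "F i = F j" "i \<noteq> j"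
  define a :: "nat \<Rightarrow> complex" where "a l = (if l = i then 1 else if l = j then - 1 else 0)" for l
  have "(\<Sum>l<m. a l *s F l) = (\<Sum>l\<in>{i, j}. a l *s F l)"
    using ij by (intro sum.mono_neutral_right) (auto simp: a_def)
  also have "\<dots> = 0" using ij by (simp add: a_def)
  finally have "a i = 0"
    using quotient_framesD(2) [OF assms(2), of a i] ij vec.subspace_0 [OF assms(1)] by simp
  then show False by (simp add: a_def)
qed

context
  fixes V R :: "(complex^'n::finite) set"
  assumes V: "vec.subspace V" and R: "vec.subspace R" and RV: "R \<subseteq> V"
begin

lemma frame_span_eq_quotient_image:
  assumes "F \<in> quotient_frames V R m"
  shows "frame_span R m F = quotient_image R (frame_sum R m F)"
    and "vec.dim (frame_sum R m F) = vec.dim R + m"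
proof -
  obtain K where K: "frame_span R m F = quotient_image R K" "vec.subspace K" "R \<subseteq> K"
    "vec.dim K = vec.dim R + m"
    using frame_span_in_grassmannian [OF V R RV assms] by (auto simp: grassmannian_def)
  then have "frame_sum R m F = K"
    using Union_quotient_image_subspace [OF K(2) R K(3)] Union_frame_span [of R m F] by simp
  then show "frame_span R m F = quotient_image R (frame_sum R m F)"
    and "vec.dim (frame_sum R m F) = vec.dim R + m"
    using K by simp_all
qed

text \<open>Extend a basis of R to one of K; the added vectors form the tuple.\<close>

lemma quotient_frame_exists:
  assumes K: "vec.subspace K" "R \<subseteq> K" "K \<subseteq> V" and dim: "vec.dim K = vec.dim R + m"
  obtains F where "F \<in> quotient_frames V R m" "frame_sum R m F = K"
proof -
  obtain B where B: "B \<subseteq> R" "vec.independent B" "R \<subseteq> vec.span B" "card B = vec.dim R"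
    by (rule vec.basis_exists)
  obtain B' where B': "B \<subseteq> B'" "B' \<subseteq> K" "vec.independent B'" "K \<subseteq> vec.span B'"
    using vec.maximal_independent_subset_extend [of B K] B K by blast
  have fin: "finite B'" using B'(3) by (rule vec.finiteI_independent)
  have finB: "finite B" using B'(1) fin by (rule finite_subset)
  have "card B' = vec.dim K"
    by (rule vec.basis_card_eq_dim [OF B'(2,4,3)])
  then have "card (B' - B) = m"
    using B'(1) dim B(4) finB by (simp add: card_Diff_subset)
  then obtain f where f: "bij_betw f {..<m} (B' - B)"
    using ex_bij_betw_nat_finite [of "B' - B"] fin by (auto simp: atLeast0LessThan)
  define F where "F = (\<lambda>i\<in>{..<m}. f i)"
  have f': "f i \<in> B' - B" if "i < m" for i
    using f that by (auto simp: bij_betw_def)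
  have "a i = 0" if a: "(\<Sum>i<m. a i *s F i) \<in> R" and i: "i < m" for a i
  proof -
    obtain u where u: "(\<Sum>i<m. a i *s F i) = (\<Sum>x\<in>B. u x *s x)"
      using a B(3) vec.span_finite [OF finB] by blast
    \<comment> \<open>Collects both sides of the relation into one on the basis of K, with the sign
      reversed on the part in R.\<close>
    define g where "g x = (if x \<in> B then - u x else a (inv_into {..<m} f x))" for x
    have "(\<Sum>x\<in>B'. g x *s x) = (\<Sum>x\<in>B' - B. g x *s x) + (\<Sum>x\<in>B. g x *s x)"
      using fin B'(1) by (rule sum.subset_diff [OF _ , rotated])
    also have "(\<Sum>x\<in>B. g x *s x) = - (\<Sum>x\<in>B. u x *s x)"
      by (simp add: g_def vec.scale_minus_left sum_negf)
    also have "(\<Sum>x\<in>B' - B. g x *s x) = (\<Sum>i<m. g (f i) *s f i)"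
      by (rule sum.reindex_bij_betw [OF f, symmetric])
    also have "\<dots> = (\<Sum>i<m. a i *s F i)"
      using f f' by (intro sum.cong) (auto simp: g_def F_def bij_betw_def)
    finally have "(\<Sum>x\<in>B'. g x *s x) = 0" by (simp add: u)
    then have "g (f i) = 0"
      using vec.independentD [OF B'(3) fin order_refl, of g "f i"] f' [OF i] by blast
    then show ?thesis
      using f f' [OF i] i by (simp add: g_def bij_betw_def)
  qed
  moreover have "f i \<in> V" if "i < m" for i
    using f' [OF that] B'(2) K(3) by blast
  ultimately have F: "F \<in> quotient_frames V R m"
    by (auto simp: quotient_frames_def F_def)
  moreover have "frame_sum R m F = K"
  proof (rule vec.subspace_dim_equal)
    show "frame_sum R m F \<subseteq> K"
      using f' B'(2) by (intro frame_sum_subset K) (auto simp: F_def)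
    show "vec.dim K \<le> vec.dim (frame_sum R m F)"
      using dim frame_span_eq_quotient_image(2) [OF F] by simp
  qed (use K subspace_frame_sum [OF R] in auto)
  ultimately show thesis by (rule that)
qed

lemma mem_grassmannian_iff:
  "P \<in> grassmannian V R m \<longleftrightarrow> (\<exists>F\<in>quotient_frames V R m. P = frame_span R m F)"
proof
  assume "P \<in> grassmannian V R m"
  then obtain K where K: "P = quotient_image R K" "vec.subspace K" "R \<subseteq> K" "K \<subseteq> V"
    "vec.dim K = vec.dim R + m"
    by (auto simp: grassmannian_def)
  obtain F where "F \<in> quotient_frames V R m" "frame_sum R m F = K"
    by (rule quotient_frame_exists [OF K(2-)])
  then show "\<exists>F\<in>quotient_frames V R m. P = frame_span R m F"
    using K(1) frame_span_eq_quotient_image(1) by metis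
qed (use frame_span_in_grassmannian [OF V R RV] in blast)

end

text \<open>A point of C in K is a combination of the frame plus an element of R, so it expresses a
  dependence modulo R + C; if all its coefficients vanish it lies in both R and C and is 0. The
  condition becomes membership in \<open>quotient_frames\<close> for a larger subspace, where the
  general results on frames apply.\<close>

lemma frame_sum_Int_trivial_iff:
  assumes R: "vec.subspace R" and C: "vec.subspace C" and RC: "R \<inter> C = {0}"
    and F: "F \<in> quotient_frames V R m"
  shows "frame_sum R m F \<inter> C = {0} \<longleftrightarrow> F \<in> quotient_frames V {x + y |x y. x \<in> R \<and> y \<in> C} m"
proof
  assume *: "frame_sum R m F \<inter> C = {0}"
  have "a i = 0" if "(\<Sum>i<m. a i *s F i) = r + c" "r \<in> R" "c \<in> C" "i < m" for a r c i
  proof -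
    have "c = (\<Sum>i<m. a i *s F i) + - r" using that(1) by simp
    moreover have "- r \<in> R" using that(2) R vec.subspace_neg by blast
    ultimately have "c \<in> frame_sum R m F" unfolding mem_frame_sum by blast
    then have "c = 0" using * that(3) by blast
    then show ?thesis using quotient_framesD(2) [OF F, of a i] that by simp
  qed
  then show "F \<in> quotient_frames V {x + y |x y. x \<in> R \<and> y \<in> C} m"
    using F by (auto simp: quotient_frames_def)
next
  assume *: "F \<in> quotient_frames V {x + y |x y. x \<in> R \<and> y \<in> C} m"
  have "x = 0" if "x \<in> frame_sum R m F" "x \<in> C" for x
  proof -
    obtain a r where a: "x = (\<Sum>i<m. a i *s F i) + r" "r \<in> R"
      using \<open>x \<in> frame_sum R m F\<close> unfolding mem_frame_sum by blast
    then have "(\<Sum>i<m. a i *s F i) = - r + x" by simp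
    moreover have "- r \<in> R" using a(2) R vec.subspace_neg by blast
    ultimately have "(\<Sum>i<m. a i *s F i) \<in> {x + y |x y. x \<in> R \<and> y \<in> C}"
      using \<open>x \<in> C\<close> by blast
    then have "a i = 0" if "i < m" for i
      using quotient_framesD(2) [OF *] that by blast
    then have "x = r" using a(1) by simp
    then show ?thesis using a(2) \<open>x \<in> C\<close> RC by blast
  qed
  then show "frame_sum R m F \<inter> C = {0}"
    using vec.subspace_0 [OF subspace_frame_sum [OF R]] vec.subspace_0 [OF C] by blast
qed

text \<open>A basis of R and the frame are jointly independent, so a functional can be prescribed on
  them: zero on the former, dual on the latter.\<close>

lemma dual_functionals_exist:
  fixes V R :: "(complex^'n::finite) set"
  assumes R: "vec.subspace R" and F: "F \<in> quotient_frames V R m"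
  obtains \<gamma> where "\<And>i x. i < m \<Longrightarrow> x \<in> R \<Longrightarrow> cdot (\<gamma> i) x = 0"
    "\<And>i j. i < m \<Longrightarrow> j < m \<Longrightarrow> cdot (\<gamma> i) (F j) = (if j = i then 1 else 0)"
proof -
  note ind = quotient_framesD(2) [OF F]
  have inj: "inj_on F {..<m}" by (rule quotient_frames_inj_on [OF R F])
  have notR: "F i \<notin> R" if i: "i < m" for i
  proof
    have "(\<Sum>j<m. (if j = i then 1 else 0) *s F j) = (\<Sum>j<m. if j = i then F j else 0)"
      by (intro sum.cong) auto
    also have "\<dots> = F i" using i by simp
    finally have *: "(\<Sum>j<m. (if j = i then 1 else 0) *s F j) = F i" .
    assume "F i \<in> R"
    then show False using ind [of "\<lambda>j. if j = i then 1 else 0" i] i * by simp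
  qed
  obtain B where B: "B \<subseteq> R" "vec.independent B" "R \<subseteq> vec.span B" "card B = vec.dim R"
    by (rule vec.basis_exists)
  have finB: "finite B" using B(2) by (rule vec.finiteI_independent)
  have disj: "B \<inter> F ` {..<m} = {}" using B(1) notR by auto
  have indep: "vec.independent (B \<union> F ` {..<m})"
  proof (rule vec.independent_if_scalars_zero)
    fix u x assume "(\<Sum>x\<in>B \<union> F ` {..<m}. u x *s x) = 0" and x: "x \<in> B \<union> F ` {..<m}"
    then have sum0: "(\<Sum>x\<in>B. u x *s x) + (\<Sum>i<m. u (F i) *s F i) = 0"
      using finB disj inj by (simp add: sum.union_disjoint sum.reindex)
    then have "(\<Sum>i<m. u (F i) *s F i) = - (\<Sum>x\<in>B. u x *s x)"
      by (simp add: eq_neg_iff_add_eq_0 add.commute)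
    moreover have "- (\<Sum>x\<in>B. u x *s x) \<in> R"
      using B(1) R by (intro vec.subspace_neg vec.subspace_sum vec.subspace_scale) auto
    ultimately have "(\<Sum>i<m. u (F i) *s F i) \<in> R"
      by simp
    then have uF: "u (F i) = 0" if "i < m" for i
      using ind [of "\<lambda>i. u (F i)"] that by blast
    then have "(\<Sum>x\<in>B. u x *s x) = 0" using sum0 by simp
    then have "u y = 0" if "y \<in> B" for y
      using vec.independentD [OF B(2) finB order_refl, of u y] that by blast
    then show "u x = 0" using x uF by blast
  qed (use finB in auto)
  have "\<exists>\<gamma>. (\<forall>x\<in>R. cdot \<gamma> x = 0) \<and> (\<forall>j<m. cdot \<gamma> (F j) = (if j = i then 1 else 0))"
    if i: "i < m" for i
  proof -
    \<comment> \<open>Any label serves: the functional is obtained as one coordinate of a linear map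
      into \<complex>^n.\<close>
    define a where "a = (undefined :: 'n)"
    obtain g :: "complex^'n \<Rightarrow> complex^'n" where g: "Vector_Spaces.linear (*s) (*s) g"
      and gB: "\<And>x. x \<in> B \<union> F ` {..<m} \<Longrightarrow> g x = (if x = F i then axis a 1 else 0)"
      using vec.linear_independent_extend [OF indep, of "\<lambda>x. if x = F i then axis a 1 else 0"]
      by blast
    have g_eq: "cdot (\<chi> q. g (axis q 1) $ a) x = g x $ a" for x
    proof -
      have "g x = g (\<Sum>q\<in>UNIV. x $ q *s axis q 1)" by (simp add: basis_expansion)
      also have "\<dots> = (\<Sum>q\<in>UNIV. x $ q *s g (axis q 1))"
        by (simp add: vec.linear_sum [OF g] vec.linear_scale [OF g])
      finally show ?thesis by (simp add: cdot_def mult.commute)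
    qed
    have "g x = 0" if "x \<in> R" for x
    proof -
      obtain u where "x = (\<Sum>x\<in>B. u x *s x)"
        using \<open>x \<in> R\<close> B(3) vec.span_finite [OF finB] by blast
      moreover have "g y = 0" if "y \<in> B" for y
        using gB [of y] that disj i by auto
      ultimately show ?thesis
        by (simp add: vec.linear_sum [OF g] vec.linear_scale [OF g])
    qed
    moreover have "g (F j) $ a = (if j = i then 1 else 0)" if "j < m" for j
      using gB [of "F j"] that i inj by (auto simp: inj_on_eq_iff)
    ultimately show ?thesis
      by (intro exI [of _ "\<chi> q. g (axis q 1) $ a"]) (simp add: g_eq)
  qed
  then obtain \<gamma> where "\<And>i. i < m \<Longrightarrow>
      (\<forall>x\<in>R. cdot (\<gamma> i) x = 0) \<and> (\<forall>j<m. cdot (\<gamma> i) (F j) = (if j = i then 1 else 0))"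
    by metis
  then show thesis using that [of \<gamma>] by blast
qed


section \<open>The transition matrix\<close>

text \<open>The matrix of \<open>x \<mapsto> x + \<Sum>\<^sub>i \<gamma>\<^sub>i(x) (F\<^sub>i - G\<^sub>i)\<close>: it sends \<open>G\<^sub>i\<close> to \<open>F\<^sub>i\<close> and fixes the common kernel of
  the functionals \<open>\<gamma>\<^sub>i\<close> dual to \<open>G\<^sub>i\<close>.\<close>

definition transition ::
  "nat \<Rightarrow> (nat \<Rightarrow> complex^'n::finite) \<Rightarrow> (nat \<Rightarrow> complex^'n) \<Rightarrow> (nat \<Rightarrow> complex^'n) \<Rightarrow> complex^'n^'n" where
  "transition m \<gamma> G F = (\<chi> p q. (if p = q then 1 else 0) + (\<Sum>i<m. \<gamma> i $ q * (F i $ p - G i $ p)))"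

lemma transition_mult:
  "transition m \<gamma> G F *v x = x + (\<Sum>i<m. cdot (\<gamma> i) x *s (F i - G i))"
proof -
  have "(\<Sum>q\<in>UNIV. ((if p = q then 1 else 0) + (\<Sum>i<m. \<gamma> i $ q * (F i $ p - G i $ p))) * x $ q) =
      x $ p + (\<Sum>i<m. cdot (\<gamma> i) x * (F i $ p - G i $ p))" for p
  proof -
    have "(\<Sum>q\<in>UNIV. (\<Sum>i<m. \<gamma> i $ q * (F i $ p - G i $ p)) * x $ q) =
        (\<Sum>i<m. \<Sum>q\<in>UNIV. (\<gamma> i $ q * x $ q) * (F i $ p - G i $ p))"
      unfolding sum_distrib_right by (subst sum.swap) (intro sum.cong refl, simp)
    moreover have "(\<Sum>q\<in>UNIV. (if p = q then 1 else 0) * x $ q) = x $ p"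
      by (simp add: if_distrib if_distribR cong: if_cong)
    ultimately show ?thesis
      by (simp add: distrib_right sum.distrib cdot_def flip: sum_distrib_right)
  qed
  then show ?thesis
    by (simp add: transition_def matrix_vector_mult_def vec_eq_iff right_diff_distrib)
qed

lemma det_nonzero_iff_ker:
  fixes A :: "complex^'n::finite^'n"
  shows "det A \<noteq> 0 \<longleftrightarrow> (\<forall>x. A *v x = 0 \<longrightarrow> x = 0)"
  by (metis invertible_det_nz invertible_left_inverse matrix_left_invertible_ker)

text \<open>By Sylvester's identity the determinant equals that of the m x m matrix of the numbers
  \<open>cdot (\<gamma> k) (F i)\<close>, whose injectivity is the right-hand side. The proof
  compares the kernels directly.\<close>

lemma det_transition_nonzero_iff:
  assumes dual: "\<And>i j. i < m \<Longrightarrow> j < m \<Longrightarrow> cdot (\<gamma> i) (G j) = (if j = i then 1 else 0)"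
  shows "det (transition m \<gamma> G F) \<noteq> 0 \<longleftrightarrow>
    (\<forall>a. (\<forall>k<m. cdot (\<gamma> k) (\<Sum>i<m. a i *s F i) = 0) \<longrightarrow> (\<forall>i<m. a i = 0))"
proof -
  have dual_sum: "cdot (\<gamma> k) (\<Sum>i<m. a i *s G i) = a k" if "k < m" for a k
  proof -
    have "cdot (\<gamma> k) (\<Sum>i<m. a i *s G i) = (\<Sum>i<m. if i = k then a i else 0)"
      unfolding cdot_simps using dual that by (intro sum.cong) auto
    then show ?thesis using that by simp
  qed
  show ?thesis
    unfolding det_nonzero_iff_ker
  proof (intro iffI allI impI)
    fix a i
    assume ker: "\<forall>x. transition m \<gamma> G F *v x = 0 \<longrightarrow> x = 0"
      and a: "\<forall>k<m. cdot (\<gamma> k) (\<Sum>i<m. a i *s F i) = 0" and i: "i < m"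
    \<comment> \<open>A dependence \<open>a\<close> of the F_i under the functionals yields a kernel
      vector whose coordinates are again \<open>a\<close>.\<close>
    define x where "x = (\<Sum>i<m. a i *s G i) - (\<Sum>i<m. a i *s F i)"
    have c: "cdot (\<gamma> k) x = a k" if "k < m" for k
      using a that dual_sum [OF that] by (simp add: x_def cdot_diff)
    have "transition m \<gamma> G F *v x = x + (\<Sum>i<m. a i *s F i) - (\<Sum>i<m. a i *s G i)"
      by (simp add: transition_mult c vec.scale_right_diff_distrib sum_subtractf)
    then have "transition m \<gamma> G F *v x = 0" by (simp add: x_def)
    then have "x = 0" using ker by blast
    then show "a i = 0" using c [OF i] by (simp add: cdot_zero)
  next
    fix x
    assume ind: "\<forall>a. (\<forall>k<m. cdot (\<gamma> k) (\<Sum>i<m. a i *s F i) = 0) \<longrightarrow> (\<forall>i<m. a i = 0)"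
      and x: "transition m \<gamma> G F *v x = 0"
    \<comment> \<open>Conversely, the coordinates of a kernel vector are such a dependence.\<close>
    have eq: "(\<Sum>i<m. cdot (\<gamma> i) x *s F i) = (\<Sum>i<m. cdot (\<gamma> i) x *s G i) - x"
      using x by (simp add: transition_mult vec.scale_right_diff_distrib sum_subtractf algebra_simps)
    have "cdot (\<gamma> k) (\<Sum>i<m. cdot (\<gamma> i) x *s F i) = 0" if "k < m" for k
      unfolding eq using dual_sum [OF that, of "\<lambda>i. cdot (\<gamma> i) x"] by (simp add: cdot_diff)
    then have "\<forall>i<m. cdot (\<gamma> i) x = 0"
      by (intro mp [OF spec [OF ind, of "\<lambda>i. cdot (\<gamma> i) x"]]) simp
    then show "x = 0" using x by (simp add: transition_mult)
  qed
qed

lemma det_transition_self: "det (transition m \<gamma> G G) = 1"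
proof -
  have "transition m \<gamma> G G = mat 1"
    by (simp add: transition_def mat_def)
  then show ?thesis by simp
qed

text \<open>The functionals vanish on R, so a combination of the F_i in R has zero coordinates, and
  the determinant forces its coefficients to vanish.\<close>

lemma quotient_frames_if_det:
  assumes "\<And>i j. i < m \<Longrightarrow> j < m \<Longrightarrow> cdot (\<gamma> i) (G j) = (if j = i then 1 else 0)"
    and "\<And>i x. i < m \<Longrightarrow> x \<in> R \<Longrightarrow> cdot (\<gamma> i) x = 0"
    and "det (transition m \<gamma> G F) \<noteq> 0" "F \<in> {..<m} \<rightarrow>\<^sub>E V"
  shows "F \<in> quotient_frames V R m"
proof -
  have "\<forall>i<m. a i = 0" if "(\<Sum>i<m. a i *s F i) \<in> R" for a
    using det_transition_nonzero_iff [of m \<gamma> G F] assms(1-3) that by simp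
  then show ?thesis
    using assms(4) by (simp add: quotient_frames_def)
qed

text \<open>In the Leibniz expansion every entry is a polynomial of degree at most one in t.\<close>

lemma det_affine_poly:
  fixes A B :: "complex^'n::finite^'n"
  obtains p where "\<And>t. det (\<chi> i j. A $ i $ j + t * B $ i $ j) = poly p t"
proof
  show "det (\<chi> i j. A $ i $ j + t * B $ i $ j) =
      poly (\<Sum>\<pi>\<in>{\<pi>. \<pi> permutes UNIV}. of_int (sign \<pi>) * (\<Prod>i\<in>UNIV. [:A $ i $ \<pi> i, B $ i $ \<pi> i:])) t" for t
    by (simp add: det_def poly_sum poly_prod)
qed

lemma transition_affine:
  "transition m \<gamma> G (\<lambda>i\<in>{..<m}. F i + t *s H i) =
     (\<chi> p q. transition m \<gamma> G F $ p $ q + t * (\<Sum>i<m. \<gamma> i $ q * H i $ p))"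
proof -
  have "(\<Sum>i<m. \<gamma> i $ q * (restrict (\<lambda>i. F i + t *s H i) {..<m} i $ p - G i $ p)) =
      (\<Sum>i<m. \<gamma> i $ q * (F i $ p - G i $ p) + t * (\<gamma> i $ q * H i $ p))" for p q
    by (intro sum.cong) (auto simp: algebra_simps)
  then show ?thesis
    by (simp add: transition_def vec_eq_iff sum.distrib sum_distrib_left)
qed

text \<open>Along a line through a frame independence fails only at the roots of a nonzero polynomial.\<close>

lemma finite_line_not_quotient_frames:
  assumes R: "vec.subspace R" and V: "vec.subspace V"
    and F: "F \<in> quotient_frames V R m" and H: "\<And>i. i < m \<Longrightarrow> H i \<in> V"
  shows "finite {t. (\<lambda>i\<in>{..<m}. F i + t *s H i) \<notin> quotient_frames V R m}"
proof -
  obtain \<gamma> where \<gamma>: "\<And>i x. i < m \<Longrightarrow> x \<in> R \<Longrightarrow> cdot (\<gamma> i) x = 0"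
    "\<And>i j. i < m \<Longrightarrow> j < m \<Longrightarrow> cdot (\<gamma> i) (F j) = (if j = i then 1 else 0)"
    using dual_functionals_exist [OF R F] by metis
  obtain p where p: "\<And>t. det (transition m \<gamma> F (\<lambda>i\<in>{..<m}. F i + t *s H i)) = poly p t"
    using det_affine_poly [of "transition m \<gamma> F F" "\<chi> p q. \<Sum>i<m. \<gamma> i $ q * H i $ p"]
    unfolding transition_affine by auto
  \<comment> \<open>At t = 0 the line passes through F, where the matrix is the identity; hence the
    polynomial is not zero.\<close>
  have "transition m \<gamma> F (\<lambda>i\<in>{..<m}. F i + 0 *s H i) = transition m \<gamma> F F"
    unfolding transition_affine by (simp add: vec_eq_iff)
  then have "poly p 0 = 1"
    using p [of 0] by (simp add: det_transition_self)
  then have "p \<noteq> 0" by auto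
  have "(\<lambda>i\<in>{..<m}. F i + t *s H i) \<in> {..<m} \<rightarrow>\<^sub>E V" for t
    using quotient_framesD(1) [OF F] H V by (auto intro!: vec.subspace_add vec.subspace_scale)
  then have "(\<lambda>i\<in>{..<m}. F i + t *s H i) \<in> quotient_frames V R m" if "poly p t \<noteq> 0" for t
    using that p by (intro quotient_frames_if_det [where \<gamma> = \<gamma> and G = F]) (simp_all add: \<gamma>)
  then have "{t. (\<lambda>i\<in>{..<m}. F i + t *s H i) \<notin> quotient_frames V R m} \<subseteq> {t. poly p t = 0}"
    by blast
  then show ?thesis
    using poly_roots_finite [OF \<open>p \<noteq> 0\<close>] by (rule finite_subset)
qed

section \<open>The topology of the Grassmannian\<close>

abbreviation tuple_topology :: "(complex^'n::finite) set \<Rightarrow> nat \<Rightarrow> (nat \<Rightarrow> complex^'n) topology" where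
  "tuple_topology V m \<equiv> product_topology (\<lambda>_. top_of_set V) {..<m}"

lemma quotient_frames_subset_topspace: "quotient_frames V R m \<subseteq> topspace (tuple_topology V m)"
  by (auto simp: quotient_frames_def)

lemma tendsto_det:
  fixes A :: "'a \<Rightarrow> complex^'n::finite^'n"
  assumes "\<And>p q. ((\<lambda>x. A x $ p $ q) \<longlongrightarrow> B $ p $ q) F"
  shows "((\<lambda>x. det (A x)) \<longlongrightarrow> det B) F"
  unfolding det_def by (intro tendsto_intros assms)

lemma tendsto_tuple_component:
  assumes "F \<in> {..<m} \<rightarrow>\<^sub>E V" "i < m"
  shows "((\<lambda>G. G i $ p) \<longlongrightarrow> F i $ p) (atin (tuple_topology V m) F)"
proof -
  have "continuous_map (tuple_topology V m) (top_of_set V) (\<lambda>G. G i)"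
    using assms(2) by (intro continuous_map_product_projection) simp
  then have "continuous_map (tuple_topology V m) euclidean (\<lambda>G. G i)"
    using continuous_map_in_subtopology by blast
  then have "((\<lambda>G. G i) \<longlongrightarrow> F i) (atin (tuple_topology V m) F)"
    using assms(1) by (simp add: continuous_map_atin)
  then show ?thesis by (rule tendsto_vec_nth)
qed

lemma tendsto_transition:
  assumes "F \<in> {..<m} \<rightarrow>\<^sub>E V"
  shows "((\<lambda>F. transition m \<gamma> G F $ p $ q) \<longlongrightarrow> transition m \<gamma> G F $ p $ q) (atin (tuple_topology V m) F)"
  unfolding transition_def vec_lambda_beta
  by (intro tendsto_intros tendsto_tuple_component assms) simp

text \<open>The determinant of the transition from F is 1 at F, so it stays nonzero nearby and keeps
  the tuples independent. The subspace is arbitrary because the lemma serves both R and R +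
  C.\<close>

lemma openin_quotient_frames:
  assumes R: "vec.subspace R"
  shows "openin (tuple_topology V m) (quotient_frames V R m)"
proof (subst openin_subopen, rule ballI)
  fix F assume F: "F \<in> quotient_frames V R m"
  obtain \<gamma> where \<gamma>: "\<And>i x. i < m \<Longrightarrow> x \<in> R \<Longrightarrow> cdot (\<gamma> i) x = 0"
    "\<And>i j. i < m \<Longrightarrow> j < m \<Longrightarrow> cdot (\<gamma> i) (F j) = (if j = i then 1 else 0)"
    using dual_functionals_exist [OF R F] by metis
  let ?W = "{G \<in> topspace (tuple_topology V m). det (transition m \<gamma> F G) \<in> - {0}}"
  have "continuous_map (tuple_topology V m) euclidean (\<lambda>G. det (transition m \<gamma> F G))"
    unfolding continuous_map_atin by (auto intro!: tendsto_det tendsto_transition)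
  then have "openin (tuple_topology V m) ?W"
    by (rule openin_continuous_map_preimage) (simp flip: open_openin add: open_Compl)
  moreover have "F \<in> ?W"
    using quotient_framesD(3) [OF F] by (simp add: det_transition_self)
  moreover have "?W \<subseteq> quotient_frames V R m"
  proof
    fix G assume "G \<in> ?W"
    then show "G \<in> quotient_frames V R m"
      by (intro quotient_frames_if_det [where \<gamma> = \<gamma> and G = F]) (simp_all add: \<gamma>)
  qed
  ultimately show "\<exists>T. openin (tuple_topology V m) T \<and> F \<in> T \<and> T \<subseteq> quotient_frames V R m"
    by blast
qed

lemma topspace_frame_topology: "topspace (frame_topology V R m) = quotient_frames V R m"
  by (auto simp: frame_topology_def quotient_frames_def)

lemma openin_frame_topology:
  assumes "vec.subspace R"
  shows "openin (frame_topology V R m) W \<longleftrightarrow> openin (tuple_topology V m) W \<and> W \<subseteq> quotient_frames V R m"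
  unfolding frame_topology_def using openin_quotient_frames [OF assms]
  by (simp add: openin_open_subtopology)

section \<open>Subspaces transverse to a countable family: openness, density and cardinality\<close>

definition transverse_subspaces ::
  "(complex^'n::finite) set \<Rightarrow> (complex^'n) set \<Rightarrow> nat \<Rightarrow> (complex^'n) set set \<Rightarrow> (complex^'n) set set" where
  "transverse_subspaces V R m \<C> = {K. vec.subspace K \<and> R \<subseteq> K \<and> K \<subseteq> V \<and> vec.dim K = vec.dim R + m \<and>
      (\<forall>C\<in>\<C>. K \<inter> C = {0})}"

context
  fixes V R :: "(complex^'n::finite) set"
  assumes V: "vec.subspace V" and R: "vec.subspace R" and RV: "R \<subseteq> V"
begin

lemma continuous_map_frame_span:
  "continuous_map (frame_topology V R m) (grassmannian_topology V R m) (frame_span R m)"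
  unfolding continuous_map_def topspace_frame_topology
    topspace_grassmannian_topology [OF V R RV] openin_grassmannian_topology
  using frame_span_in_grassmannian [OF V R RV] by blast

text \<open>Universal property of the quotient topology over an open set: the frames over
  \<open>U\<close> form an open saturated set, so continuity may be tested on them.\<close>

lemma continuous_map_from_grassmannian:
  assumes U: "openin (grassmannian_topology V R m) U"
    and f: "continuous_map (subtopology (frame_topology V R m)
        {F \<in> quotient_frames V R m. frame_span R m F \<in> U}) Y (f \<circ> frame_span R m)"
  shows "continuous_map (subtopology (grassmannian_topology V R m) U) Y f"
proof -
  let ?X = "grassmannian_topology V R m" and ?FT = "frame_topology V R m"
  let ?W = "{F \<in> quotient_frames V R m. frame_span R m F \<in> U}"
  have UG: "U \<subseteq> grassmannian V R m" and W: "openin ?FT ?W"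
    using U by (auto simp: openin_grassmannian_topology)
  have topU: "topspace (subtopology ?X U) = U"
    using UG by (auto simp: topspace_grassmannian_topology [OF V R RV])
  have topW: "topspace (subtopology ?FT ?W) = ?W"
    by (auto simp: topspace_frame_topology)
  show ?thesis
    unfolding continuous_map_def topU
  proof (intro conjI allI impI)
    show "f \<in> U \<rightarrow> topspace Y"
    proof
      fix P assume "P \<in> U"
      moreover obtain F where "F \<in> quotient_frames V R m" "P = frame_span R m F"
        using UG \<open>P \<in> U\<close> mem_grassmannian_iff [OF V R RV, of P m] by blast
      ultimately have "F \<in> ?W" "P = frame_span R m F" by auto
      then show "f P \<in> topspace Y"
        using funcset_mem [OF continuous_map_funspace [OF f], unfolded topW] by auto
    qed
    fix S assume S: "openin Y S"
    have "openin (subtopology ?FT ?W) {F \<in> ?W. (f \<circ> frame_span R m) F \<in> S}"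
      using openin_continuous_map_preimage [OF f S] unfolding topW .
    then have "openin ?FT {F \<in> ?W. (f \<circ> frame_span R m) F \<in> S}"
      using W by (rule openin_trans_full)
    moreover have "{F \<in> ?W. (f \<circ> frame_span R m) F \<in> S} =
        {F \<in> quotient_frames V R m. frame_span R m F \<in> {P \<in> U. f P \<in> S}}"
      by auto
    ultimately have "openin ?X {P \<in> U. f P \<in> S}"
      using UG by (auto simp: openin_grassmannian_topology)
    then show "openin (subtopology ?X U) {P \<in> U. f P \<in> S}"
      by (simp add: openin_open_subtopology [OF U])
  qed
qed

lemma inj_on_quotient_image: "inj_on (quotient_image R) {K. vec.subspace K \<and> R \<subseteq> K}"
  by (rule inj_onI) (metis (mono_tags) R Union_quotient_image_subspace mem_Collect_eq)

lemma quotient_image_eq_frame_span: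
  assumes "F \<in> quotient_frames V R m" "quotient_image R K = frame_span R m F" "vec.subspace K" "R \<subseteq> K"
  shows "K = frame_sum R m F"
  using Union_quotient_image_subspace [OF assms(3) R assms(4)] assms(2) Union_frame_span [of R m F] by simp

lemma frame_sum_transverse_iff:
  assumes "F \<in> quotient_frames V R m"
  shows "frame_sum R m F \<in> transverse_subspaces V R m \<C> \<longleftrightarrow> (\<forall>C\<in>\<C>. frame_sum R m F \<inter> C = {0})"
  using subspace_frame_sum [OF R] subset_frame_sum [of R m F] frame_span_eq_quotient_image(2) [OF V R RV assms]
    frame_sum_subset [OF V RV quotient_framesD(1) [OF assms]]
  by (simp add: transverse_subspaces_def)

text \<open>A point of the Grassmannian determines its subspace, so transversality can be read off
  from any frame that represents it.\<close>

lemma frame_span_transverse_iff: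
  assumes F: "F \<in> quotient_frames V R m"
  shows "frame_span R m F \<in> quotient_image R ` transverse_subspaces V R m \<C> \<longleftrightarrow>
    (\<forall>C\<in>\<C>. frame_sum R m F \<inter> C = {0})"
proof
  assume "frame_span R m F \<in> quotient_image R ` transverse_subspaces V R m \<C>"
  then obtain K where K: "K \<in> transverse_subspaces V R m \<C>" "quotient_image R K = frame_span R m F"
    by auto
  then have "K = frame_sum R m F"
    using F by (intro quotient_image_eq_frame_span) (auto simp: transverse_subspaces_def)
  then show "\<forall>C\<in>\<C>. frame_sum R m F \<inter> C = {0}"
    using K(1) by (auto simp: transverse_subspaces_def)
next
  assume "\<forall>C\<in>\<C>. frame_sum R m F \<inter> C = {0}"
  then show "frame_span R m F \<in> quotient_image R ` transverse_subspaces V R m \<C>"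
    using F frame_span_eq_quotient_image(1) [OF V R RV F] frame_sum_transverse_iff [OF F] by blast
qed

context
  fixes m :: nat and \<C> :: "(complex^'n) set set" and K0 :: "(complex^'n) set"
  assumes countable: "countable \<C>" and subspaces: "\<And>C. C \<in> \<C> \<Longrightarrow> vec.subspace C"
    and K0: "K0 \<in> transverse_subspaces V R m \<C>"
begin

text \<open>Here the existence of one transverse subspace matters: \<open>K0\<close> contains R and
  meets each C trivially.\<close>

lemma R_Int_trivial: "C \<in> \<C> \<Longrightarrow> R \<inter> C = {0}"
  using K0 vec.subspace_0 [OF R] by (fastforce simp: transverse_subspaces_def)

lemma transverse_frame_iff:
  assumes "F \<in> quotient_frames V R m"
  shows "frame_sum R m F \<in> transverse_subspaces V R m \<C> \<longleftrightarrow>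
    (\<forall>C\<in>\<C>. F \<in> quotient_frames V {x + y |x y. x \<in> R \<and> y \<in> C} m)"
  using frame_sum_transverse_iff [OF assms] frame_sum_Int_trivial_iff [OF R subspaces R_Int_trivial assms]
  by simp

lemma base_frame_exists:
  obtains F where "F \<in> quotient_frames V R m" "frame_sum R m F = K0"
  using K0 quotient_frame_exists [OF V R RV, of K0 m] by (auto simp: transverse_subspaces_def)

text \<open>The line starts at a frame of \<open>K0\<close>, which is independent modulo R and
  modulo each R + C. Each of these countably many conditions therefore fails for finitely many
  parameters only.\<close>

lemma countable_line_not_transverse:
  assumes F: "F \<in> quotient_frames V R m" "frame_sum R m F = K0" and H: "\<And>i. i < m \<Longrightarrow> H i \<in> V"
  shows "countable {t. (\<lambda>i\<in>{..<m}. F i + t *s H i) \<notin> quotient_frames V R m \<or>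
      frame_sum R m (\<lambda>i\<in>{..<m}. F i + t *s H i) \<notin> transverse_subspaces V R m \<C>}" (is "countable ?B")
proof -
  let ?bad = "\<lambda>S. {t. (\<lambda>i\<in>{..<m}. F i + t *s H i) \<notin> quotient_frames V S m}"
  have "?B \<subseteq> ?bad R \<union> (\<Union>C\<in>\<C>. ?bad {x + y |x y. x \<in> R \<and> y \<in> C})"
    using transverse_frame_iff by blast
  moreover have "finite (?bad {x + y |x y. x \<in> R \<and> y \<in> C})" if C: "C \<in> \<C>" for C
  proof (rule finite_line_not_quotient_frames [OF _ V _ H])
    show "vec.subspace {x + y |x y. x \<in> R \<and> y \<in> C}"
      by (rule vec.subspace_sums [OF R subspaces [OF C]])
    show "F \<in> quotient_frames V {x + y |x y. x \<in> R \<and> y \<in> C} m"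
      using transverse_frame_iff [OF F(1)] K0 F(2) C by blast
  qed
  moreover have "finite (?bad R)"
    by (rule finite_line_not_quotient_frames [OF R V F(1) H])
  ultimately show ?thesis
    using countable by (meson countable_Un countable_UN countable_finite countable_subset)
qed

text \<open>There is one open set for each C: its preimage consists of the tuples independent modulo
  both R and R + C.\<close>

lemma gdelta_transverse:
  "gdelta_in (grassmannian_topology V R m) (quotient_image R ` transverse_subspaces V R m \<C>)"
proof -
  let ?X = "grassmannian_topology V R m" and ?O = "\<lambda>C. quotient_image R ` transverse_subspaces V R m {C}"
  have sub: "quotient_image R ` transverse_subspaces V R m \<D> \<subseteq> grassmannian V R m" for \<D>
    by (auto simp: transverse_subspaces_def grassmannian_def)
  have "openin ?X (?O C)" if C: "C \<in> \<C>" for C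
  proof -
    let ?RC = "{x + y |x y. x \<in> R \<and> y \<in> C}"
    have "{F \<in> quotient_frames V R m. frame_span R m F \<in> ?O C} =
        quotient_frames V R m \<inter> quotient_frames V ?RC m"
      using frame_span_transverse_iff [of _ m "{C}"]
        frame_sum_Int_trivial_iff [OF R subspaces [OF C] R_Int_trivial [OF C]] by auto
    moreover have "openin (tuple_topology V m) (quotient_frames V ?RC m)"
      by (intro openin_quotient_frames vec.subspace_sums R subspaces C)
    ultimately show ?thesis
      using sub openin_quotient_frames [OF R]
      by (auto simp: openin_grassmannian_topology openin_frame_topology [OF R])
  qed
  moreover have "openin ?X (grassmannian V R m)"
    using openin_topspace [of ?X] by (simp add: topspace_grassmannian_topology [OF V R RV])
  \<comment> \<open>The whole Grassmannian is added so that the intersection runs over a nonempty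
    family even if \<C> is empty.\<close>
  ultimately have "gdelta_in ?X (\<Inter> (insert (grassmannian V R m) (?O ` \<C>)))"
    using countable by (intro gdelta_in_Inter) (auto intro: open_imp_gdelta_in)
  also have "\<Inter> (insert (grassmannian V R m) (?O ` \<C>)) = quotient_image R ` transverse_subspaces V R m \<C>"
    (is "?L = ?Rt")
  proof (rule set_eqI)
    fix P
    show "P \<in> ?L \<longleftrightarrow> P \<in> ?Rt"
    proof (cases "P \<in> grassmannian V R m")
      case True
      then obtain F where F: "F \<in> quotient_frames V R m" "P = frame_span R m F"
        using mem_grassmannian_iff [OF V R RV, of P m] by blast
      show ?thesis
        using True frame_span_transverse_iff [OF F(1)] by (simp add: F(2))
    next
      case False
      then show ?thesis using sub by blast
    qed
  qed
  finally show ?thesis .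
qed

text \<open>Join a frame of \<open>K0\<close> to a frame of the given point by a complex line. The
  parameters near the given point stay in its neighbourhood and are uncountably many, while only
  countably many are bad.\<close>

lemma dense_transverse:
  "grassmannian_topology V R m closure_of (quotient_image R ` transverse_subspaces V R m \<C>) = grassmannian V R m"
proof
  let ?X = "grassmannian_topology V R m"
  show "?X closure_of (quotient_image R ` transverse_subspaces V R m \<C>) \<subseteq> grassmannian V R m"
    using closure_of_subset_topspace [of ?X] by (simp add: topspace_grassmannian_topology [OF V R RV])
  obtain F0 where F0: "F0 \<in> quotient_frames V R m" "frame_sum R m F0 = K0"
    by (rule base_frame_exists)
  show "grassmannian V R m \<subseteq> ?X closure_of (quotient_image R ` transverse_subspaces V R m \<C>)"
  proof
    fix P assume P: "P \<in> grassmannian V R m"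
    show "P \<in> ?X closure_of (quotient_image R ` transverse_subspaces V R m \<C>)"
      unfolding in_closure_of topspace_grassmannian_topology [OF V R RV]
    proof (intro conjI P allI impI)
      fix U assume U: "P \<in> U \<and> openin ?X U"
      obtain F where F: "F \<in> quotient_frames V R m" "P = frame_span R m F"
        using P mem_grassmannian_iff [OF V R RV, of P m] by blast
      \<comment> \<open>The frame of \<open>K0\<close> sits at t = 0 and the frame of
        \<open>P\<close> at t = 1.\<close>
      define \<gamma> where "\<gamma> t = (\<lambda>i\<in>{..<m}. F0 i + t *s (F i - F0 i))" for t
      let ?W = "{F \<in> quotient_frames V R m. frame_span R m F \<in> U}"
      have FV: "F0 i \<in> V" "F i - F0 i \<in> V" if "i < m" for i
        using quotient_framesD(1) [OF F(1) that] quotient_framesD(1) [OF F0(1) that] V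
        by (auto intro: vec.subspace_diff)
      have "continuous_map euclidean (tuple_topology V m) \<gamma>"
        unfolding continuous_map_componentwise
      proof (intro conjI ballI)
        fix i assume "i \<in> {..<m}"
        then have i: "i < m" by simp
        have "((\<lambda>t. F0 i + t *s (F i - F0 i)) \<longlongrightarrow> F0 i + s *s (F i - F0 i)) (at s)" for s
          by (rule vec_tendstoI) (simp, intro tendsto_intros)
        then have "continuous_on UNIV (\<lambda>t. F0 i + t *s (F i - F0 i))"
          by (simp add: continuous_on_def)
        moreover have "F0 i + t *s (F i - F0 i) \<in> V" for t
          by (intro vec.subspace_add [OF V] vec.subspace_scale [OF V] FV i)
        ultimately show "continuous_map euclidean (top_of_set V) (\<lambda>t. \<gamma> t i)"
          using i by (auto simp: \<gamma>_def continuous_map_in_subtopology)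
      qed (auto simp: \<gamma>_def)
      moreover have "openin (tuple_topology V m) ?W"
        using U by (auto simp: openin_grassmannian_topology openin_frame_topology [OF R])
      ultimately have "openin euclidean {t \<in> topspace euclidean. \<gamma> t \<in> ?W}"
        by (rule openin_continuous_map_preimage)
      then have "open {t. \<gamma> t \<in> ?W}"
        by (simp only: open_openin [symmetric] topspace_euclidean UNIV_I simp_thms)
      moreover have "\<gamma> 1 = F"
        using quotient_framesD(3) [OF F(1)] by (auto simp: \<gamma>_def fun_eq_iff PiE_def extensional_def)
      then have "1 \<in> {t. \<gamma> t \<in> ?W}" using F U by simp
      ultimately obtain e where "e > 0" "ball 1 e \<subseteq> {t. \<gamma> t \<in> ?W}"
        using open_contains_ball by blast
      then have "uncountable {t. \<gamma> t \<in> ?W}"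
        using uncountable_ball [of e "1 :: complex"] countable_subset by blast
      moreover have "countable {t. \<gamma> t \<notin> quotient_frames V R m \<or> frame_sum R m (\<gamma> t) \<notin> transverse_subspaces V R m \<C>}"
        unfolding \<gamma>_def by (rule countable_line_not_transverse [OF F0 FV(2)])
      ultimately obtain t where t: "\<gamma> t \<in> ?W" "frame_sum R m (\<gamma> t) \<in> transverse_subspaces V R m \<C>"
        by (metis (no_types, lifting) countable_subset mem_Collect_eq subsetI)
      then have "frame_span R m (\<gamma> t) \<in> quotient_image R ` transverse_subspaces V R m \<C>"
        using frame_span_eq_quotient_image(1) [OF V R RV, of "\<gamma> t" m] by blast
      with t(1) show "\<exists>y. y \<in> quotient_image R ` transverse_subspaces V R m \<C> \<and> y \<in> U" by blast
    qed
  qed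
qed

text \<open>Move the first frame vector in a direction v outside \<open>K0\<close>. If two
  parameters gave the same subspace, it would contain v, then all original frame vectors and so
  \<open>K0\<close>; by dimension it would equal \<open>K0\<close>, which does not contain
  v.\<close>

lemma uncountable_transverse:
  assumes m: "m > 0" and v: "v \<in> V" "v \<notin> K0"
  shows "uncountable (transverse_subspaces V R m \<C>)"
proof -
  obtain F where F: "F \<in> quotient_frames V R m" "frame_sum R m F = K0"
    by (rule base_frame_exists)
  define \<gamma> where "\<gamma> t = (\<lambda>i\<in>{..<m}. F i + t *s (if i = 0 then v else 0))" for t
  let ?bad = "{t. \<gamma> t \<notin> quotient_frames V R m \<or> frame_sum R m (\<gamma> t) \<notin> transverse_subspaces V R m \<C>}"
  have "countable ?bad"
    unfolding \<gamma>_def using v(1) vec.subspace_0 [OF V]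
    by (intro countable_line_not_transverse [OF F]) auto
  then have unc: "uncountable (UNIV - ?bad)"
    by (intro uncountable_minus_countable uncountable_UNIV_complex)
  have "inj_on (\<lambda>t. frame_sum R m (\<gamma> t)) (UNIV - ?bad)"
  proof (rule inj_onI, rule ccontr)
    fix s t assume st: "s \<in> UNIV - ?bad" "t \<in> UNIV - ?bad" "s \<noteq> t"
      and eq: "frame_sum R m (\<gamma> s) = frame_sum R m (\<gamma> t)"
    let ?K = "frame_sum R m (\<gamma> s)"
    have K: "vec.subspace ?K" by (rule subspace_frame_sum [OF R])
    have "\<gamma> s 0 \<in> ?K" "\<gamma> t 0 \<in> ?K"
      using frame_in_frame_sum [OF R m] eq by auto
    then have "\<gamma> s 0 - \<gamma> t 0 \<in> ?K" by (rule vec.subspace_diff [OF K])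
    then have "(s - t) *s v \<in> ?K"
      using m by (simp add: \<gamma>_def vec.scale_left_diff_distrib)
    then have "inverse (s - t) *s ((s - t) *s v) \<in> ?K" by (rule vec.subspace_scale [OF K])
    moreover have "inverse (s - t) *s ((s - t) *s v) = v"
      using st(3) by (subst vector_smult_assoc) simp
    ultimately have vK: "v \<in> ?K" by metis
    have "F i \<in> ?K" if "i < m" for i
    proof -
      have "\<gamma> s i \<in> ?K" by (rule frame_in_frame_sum [OF R that])
      moreover have "F i = \<gamma> s i - s *s (if i = 0 then v else 0)"
        using that by (simp add: \<gamma>_def)
      ultimately show ?thesis
        using vK vec.subspace_0 [OF K] by (auto intro!: vec.subspace_diff [OF K] vec.subspace_scale [OF K])
    qed
    then have "K0 \<subseteq> ?K"
      unfolding F(2) [symmetric] by (intro frame_sum_subset K subset_frame_sum)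
    moreover have "vec.dim ?K = vec.dim K0" "vec.subspace K0"
      using st(1) K0 by (auto simp: transverse_subspaces_def)
    ultimately have "K0 = ?K"
      using K by (intro vec.subspace_dim_equal) auto
    then show False using vK v(2) by simp
  qed
  then have "uncountable ((\<lambda>t. frame_sum R m (\<gamma> t)) ` (UNIV - ?bad))"
    using unc countable_image_inj_on by blast
  moreover have "(\<lambda>t. frame_sum R m (\<gamma> t)) ` (UNIV - ?bad) \<subseteq> transverse_subspaces V R m \<C>"
    by auto
  ultimately show ?thesis using countable_subset by blast
qed

end

end

section \<open>Charts of the Grassmannian\<close>

lemma sum_lessThan_add: "(\<Sum>i<m + d. f i) = (\<Sum>i<m. f i) + (\<Sum>l<d. f (m + l))"
  for f :: "nat \<Rightarrow> 'a::comm_monoid_add"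
  by (induction d) (simp_all add: add.assoc)

text \<open>Complete F by a frame of V modulo K, the sum of R and the span of F. In a relation, the
  new coefficients vanish modulo K and then the old ones modulo R.\<close>

lemma quotient_frame_extend:
  fixes V R :: "(complex^'n::finite) set"
  assumes V: "vec.subspace V" and R: "vec.subspace R" and RV: "R \<subseteq> V"
    and F: "F \<in> quotient_frames V R m" and dim: "vec.dim V = vec.dim R + m + d"
  obtains G where "G \<in> quotient_frames V R (m + d)" "frame_sum R (m + d) G = V"
    "\<And>i. i < m \<Longrightarrow> G i = F i"
proof -
  let ?K = "frame_sum R m F"
  have K: "vec.subspace ?K" "?K \<subseteq> V"
    using subspace_frame_sum [OF R] frame_sum_subset [OF V RV quotient_framesD(1) [OF F]] by auto
  obtain W where W: "W \<in> quotient_frames V ?K d"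
    using quotient_frame_exists [OF V K V K(2) order_refl, of d] dim
      frame_span_eq_quotient_image(2) [OF V R RV F] by auto
  define G where "G = (\<lambda>i\<in>{..<m + d}. if i < m then F i else W (i - m))"
  have split: "(\<Sum>i<m + d. a i *s G i) = (\<Sum>i<m. a i *s F i) + (\<Sum>l<d. a (m + l) *s W l)" for a
    unfolding sum_lessThan_add by (intro arg_cong2 [of _ _ _ _ "(+)"] sum.cong) (auto simp: G_def)
  have "a i = 0" if a: "(\<Sum>i<m + d. a i *s G i) \<in> R" and i: "i < m + d" for a i
  proof -
    have "(\<Sum>l<d. a (m + l) *s W l) = (\<Sum>i<m. - a i *s F i) + (\<Sum>i<m + d. a i *s G i)"
      unfolding split by (simp add: vec.scale_minus_left sum_negf)
    then have "(\<Sum>l<d. a (m + l) *s W l) \<in> ?K"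
      using a unfolding mem_frame_sum by (metis (no_types))
    then have aW: "a (m + l) = 0" if "l < d" for l
      using quotient_framesD(2) [OF W, of "\<lambda>l. a (m + l)"] that by blast
    then have "(\<Sum>i<m. a i *s F i) \<in> R"
      using a unfolding split by simp
    then have "a i = 0" if "i < m" for i
      using quotient_framesD(2) [OF F, of a] that by blast
    then show ?thesis
      using aW [of "i - m"] i by (cases "i < m") auto
  qed
  moreover have "G i \<in> V" if "i < m + d" for i
    using that quotient_framesD(1) [OF F, of i] quotient_framesD(1) [OF W, of "i - m"]
    by (auto simp: G_def)
  ultimately have G: "G \<in> quotient_frames V R (m + d)"
    by (auto simp: quotient_frames_def G_def)
  moreover have "frame_sum R (m + d) G = V"
  proof (rule vec.subspace_dim_equal)
    show "frame_sum R (m + d) G \<subseteq> V"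
      by (rule frame_sum_subset [OF V RV quotient_framesD(1) [OF G]])
    show "vec.dim V \<le> vec.dim (frame_sum R (m + d) G)"
      using dim frame_span_eq_quotient_image(2) [OF V R RV G] by simp
  qed (use V subspace_frame_sum [OF R] in auto)
  ultimately show thesis
    by (rule that) (simp add: G_def)
qed

text \<open>The first m vectors of \<open>G\<close> frame the centre of a chart, the last d a
  complement in V/R; the \<gamma>_i are the coordinates of V/R in this basis, pulled back to
  V.\<close>

locale dual_frame =
  fixes V R :: "(complex^'n::finite) set" and m d :: nat
    and G \<gamma> :: "nat \<Rightarrow> complex^'n"
  assumes V: "vec.subspace V" and R: "vec.subspace R" and RV: "R \<subseteq> V"
    and G: "\<And>i. i < m + d \<Longrightarrow> G i \<in> V" and frame_sum_G: "frame_sum R (m + d) G = V"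
    and dual_R: "\<And>i x. i < m + d \<Longrightarrow> x \<in> R \<Longrightarrow> cdot (\<gamma> i) x = 0"
    and dual_G: "\<And>i j. i < m + d \<Longrightarrow> j < m + d \<Longrightarrow> cdot (\<gamma> i) (G j) = (if j = i then 1 else 0)"
begin

lemma expansion:
  assumes "v \<in> V"
  shows "v - (\<Sum>i<m + d. cdot (\<gamma> i) v *s G i) \<in> R"
proof -
  obtain a r where a: "r \<in> R" "v = (\<Sum>i<m + d. a i *s G i) + r"
    using assms unfolding frame_sum_G [symmetric] mem_frame_sum by blast
  have "cdot (\<gamma> k) v = a k" if "k < m + d" for k
  proof -
    have "cdot (\<gamma> k) v = (\<Sum>i<m + d. a i * cdot (\<gamma> k) (G i))"
      using a(1) dual_R [OF that] by (simp add: a(2) cdot_simps)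
    also have "\<dots> = (\<Sum>i<m + d. if i = k then a i else 0)"
      using dual_G that by (intro sum.cong) auto
    finally show ?thesis using that by simp
  qed
  then show ?thesis using a by simp
qed

text \<open>The complements in V/R of the span of the last d vectors of \<open>G\<close>, that is,
  the graphs over the span of the first m.\<close>

definition chart_domain :: "(complex^'n) set set set" where
  "chart_domain = {P \<in> grassmannian V R m. \<forall>x\<in>\<Union>P. (\<forall>k<m. cdot (\<gamma> k) x = 0) \<longrightarrow> x \<in> R}"

text \<open>A subspace \<open>K/R\<close> in the domain is the graph of a linear map from the span of \<open>G\<^sub>0, \<dots>, G\<^sub>m\<^sub>-\<^sub>1\<close>
  to that of \<open>G\<^sub>m, \<dots>, G\<^sub>m\<^sub>+\<^sub>d\<^sub>-\<^sub>1\<close>; the chart lists the matrix of this map row by row.\<close>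

definition chart :: "(complex^'n) set set \<Rightarrow> nat \<Rightarrow> complex" where
  "chart P = (\<lambda>j\<in>{..<m * d}. cdot (\<gamma> (m + j mod d))
     (SOME x. x \<in> \<Union>P \<and> (\<forall>k<m. cdot (\<gamma> k) x = (if k = j div d then 1 else 0))))"

text \<open>The basis of the graph that lies over the first m vectors of \<open>G\<close>. It is
  affine in \<open>x\<close>, so this lift of the inverse chart is holomorphic.\<close>

definition graph_frame :: "(nat \<Rightarrow> complex) \<Rightarrow> nat \<Rightarrow> complex^'n" where
  "graph_frame x = (\<lambda>i\<in>{..<m}. G i + (\<Sum>l<d. x (i * d + l) *s G (m + l)))"

text \<open>Cramer's rule for the preimage of \<open>G i\<close> under the transition matrix,
  written out so that the dependence on \<open>F\<close> is visibly rational.\<close>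

definition solution :: "(nat \<Rightarrow> complex^'n) \<Rightarrow> nat \<Rightarrow> complex^'n" where
  "solution F i = (\<chi> k. det (\<chi> p q. if q = k then G i $ p else transition m \<gamma> G F $ p $ q) /
     det (transition m \<gamma> G F))"

lemma index_bounds:
  assumes "j < m * d"
  shows "j div d < m" "j mod d < d" "j div d * d + j mod d = j"
proof -
  have "d > 0" using assms by (cases d) auto
  then show "j div d < m" "j mod d < d" "j div d * d + j mod d = j"
    using assms by (simp_all add: less_mult_imp_div_less)
qed

lemma index_less:
  assumes "i < m" "l < d"
  shows "i * d + l < m * d"
proof -
  have "i * d + l < Suc i * d" using assms(2) by simp
  also have "\<dots> \<le> m * d" using assms(1) by (intro mult_le_mono1) simp
  finally show ?thesis .
qed

text \<open>Two points of K with the prescribed first m coordinates differ by an element of R, where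
  the functionals vanish, so the choice made in \<open>chart\<close> is immaterial.\<close>

lemma chart_eq:
  assumes P: "P \<in> chart_domain" and j: "j < m * d" and x: "x \<in> \<Union>P"
    and xk: "\<And>k. k < m \<Longrightarrow> cdot (\<gamma> k) x = (if k = j div d then 1 else 0)"
  shows "chart P j = cdot (\<gamma> (m + j mod d)) x"
proof -
  let ?Q = "\<lambda>x. x \<in> \<Union>P \<and> (\<forall>k<m. cdot (\<gamma> k) x = (if k = j div d then 1 else 0))"
  let ?y = "SOME x. ?Q x"
  have y: "?Q ?y" by (rule someI [of ?Q x]) (use x xk in auto)
  obtain F where F: "F \<in> quotient_frames V R m" "P = frame_span R m F"
    using P mem_grassmannian_iff [OF V R RV, of P m] by (auto simp: chart_domain_def)
  have sub: "vec.subspace (\<Union>P)"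
    unfolding F(2) Union_frame_span by (rule subspace_frame_sum [OF R])
  have "?y - x \<in> \<Union>P"
    using vec.subspace_diff [OF sub] y x by blast
  moreover have "\<forall>k<m. cdot (\<gamma> k) (?y - x) = 0"
    using y xk by (simp add: cdot_diff)
  ultimately have "?y - x \<in> R"
    using P unfolding chart_domain_def by blast
  then have "cdot (\<gamma> (m + j mod d)) (?y - x) = 0"
    using dual_R [of "m + j mod d"] index_bounds [OF j] by simp
  then show ?thesis
    using j by (simp add: chart_def cdot_diff)
qed

text \<open>Modulo R a point of K is a combination of the frame, and it lies in R only if its
  coefficients vanish. So the domain condition becomes the one of
  \<open>det_transition_nonzero_iff\<close>.\<close>

lemma frame_span_in_chart_domain_iff:
  assumes F: "F \<in> quotient_frames V R m"
  shows "frame_span R m F \<in> chart_domain \<longleftrightarrow> det (transition m \<gamma> G F) \<noteq> 0"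
proof -
  have dual: "\<And>i j. i < m \<Longrightarrow> j < m \<Longrightarrow> cdot (\<gamma> i) (G j) = (if j = i then 1 else 0)"
    using dual_G by simp
  have "frame_span R m F \<in> chart_domain \<longleftrightarrow>
      (\<forall>a. (\<forall>k<m. cdot (\<gamma> k) (\<Sum>i<m. a i *s F i) = 0) \<longrightarrow> (\<forall>i<m. a i = 0))"
    (is "_ \<longleftrightarrow> ?ind")
  proof
    assume dom: "frame_span R m F \<in> chart_domain"
    show ?ind
    proof (intro allI impI)
      fix a i assume a: "\<forall>k<m. cdot (\<gamma> k) (\<Sum>i<m. a i *s F i) = 0" and i: "i < m"
      have "(\<Sum>i<m. a i *s F i) \<in> \<Union>(frame_span R m F)"
        unfolding Union_frame_span by (rule sum_in_frame_sum [OF R])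
      then have "(\<Sum>i<m. a i *s F i) \<in> R"
        using dom a unfolding chart_domain_def by blast
      then show "a i = 0" using quotient_framesD(2) [OF F] i by blast
    qed
  next
    assume ind: ?ind
    have "x \<in> R" if x: "x \<in> frame_sum R m F" "\<forall>k<m. cdot (\<gamma> k) x = 0" for x
    proof -
      obtain a r where a: "r \<in> R" "x = (\<Sum>i<m. a i *s F i) + r"
        using x(1) unfolding mem_frame_sum by blast
      then have "\<forall>k<m. cdot (\<gamma> k) (\<Sum>i<m. a i *s F i) = 0"
        using x(2) dual_R by (simp add: cdot_add)
      then have "\<forall>i<m. a i = 0" by (rule mp [OF spec [OF ind, of a]])
      then show ?thesis using a by simp
    qed
    then show "frame_span R m F \<in> chart_domain"
      using frame_span_in_grassmannian [OF V R RV F]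
      unfolding chart_domain_def mem_Collect_eq Union_frame_span by blast
  qed
  then show ?thesis
    using det_transition_nonzero_iff [of m \<gamma> G F] dual by simp
qed

lemma transition_solution:
  assumes "det (transition m \<gamma> G F) \<noteq> 0"
  shows "transition m \<gamma> G F *v solution F i = G i"
  using cramer [OF assms, of "solution F i" "G i"] by (simp add: solution_def)

text \<open>Let y be the preimage of G_i and x the combination of the F_k with coefficients
  \<gamma>_k(y). The equation for y says that x is G_i - y plus the sum of the \<gamma>_k(y) G_k.
  Under the first m functionals the contributions of y cancel; under the others only that of -y
  survives.\<close>

lemma point_over_dual_basis:
  assumes det: "det (transition m \<gamma> G F) \<noteq> 0" and i: "i < m"
  obtains x where "x \<in> frame_sum R m F" "\<And>k. k < m \<Longrightarrow> cdot (\<gamma> k) x = (if k = i then 1 else 0)"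
    "\<And>l. l < d \<Longrightarrow> cdot (\<gamma> (m + l)) x = - cdot (\<gamma> (m + l)) (solution F i)"
proof -
  let ?y = "solution F i"
  define x where "x = (\<Sum>k<m. cdot (\<gamma> k) ?y *s F k)"
  have "G i = ?y + (\<Sum>k<m. cdot (\<gamma> k) ?y *s (F k - G k))"
    using transition_solution [OF det, of i] by (simp add: transition_mult)
  then have x: "x = G i - ?y + (\<Sum>k<m. cdot (\<gamma> k) ?y *s G k)"
    by (simp add: x_def vec.scale_right_diff_distrib sum_subtractf algebra_simps)
  have "cdot (\<gamma> k) (\<Sum>l<m. a l *s G l) = (if k < m then a k else 0)" if "k < m + d" for k a
  proof -
    have "cdot (\<gamma> k) (\<Sum>l<m. a l *s G l) = (\<Sum>l<m. if l = k then a l else 0)"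
      unfolding cdot_simps using dual_G that by (intro sum.cong) auto
    then show ?thesis by simp
  qed
  then have "cdot (\<gamma> k) x = (if k = i then 1 else 0) - cdot (\<gamma> k) ?y + (if k < m then cdot (\<gamma> k) ?y else 0)"
    if "k < m + d" for k
    unfolding x cdot_add cdot_diff using dual_G [of k i] that i by simp
  then show thesis
    using i by (intro that [of x]) (simp_all add: x_def sum_in_frame_sum [OF R])
qed

text \<open>This makes the chart an explicit rational function of the frame, from which continuity
  and complex differentiability are read off.\<close>

lemma chart_frame_span:
  assumes F: "F \<in> quotient_frames V R m" and det: "det (transition m \<gamma> G F) \<noteq> 0" and j: "j < m * d"
  shows "chart (frame_span R m F) j = - cdot (\<gamma> (m + j mod d)) (solution F (j div d))"
proof -
  note jb = index_bounds [OF j]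
  obtain x where x: "x \<in> frame_sum R m F" "\<And>k. k < m \<Longrightarrow> cdot (\<gamma> k) x = (if k = j div d then 1 else 0)"
    "\<And>l. l < d \<Longrightarrow> cdot (\<gamma> (m + l)) x = - cdot (\<gamma> (m + l)) (solution F (j div d))"
    using point_over_dual_basis [OF det jb(1)] by metis
  have "chart (frame_span R m F) j = cdot (\<gamma> (m + j mod d)) x"
    using frame_span_in_chart_domain_iff [OF F] det j x(1,2)
    by (intro chart_eq) (simp_all add: Union_frame_span del: Union_iff)
  then show ?thesis using x(3) jb(2) by simp
qed

lemma cdot_graph_frame:
  assumes "i < m" "k < m + d"
  shows "cdot (\<gamma> k) (graph_frame x i) = (if k < m then if k = i then 1 else 0 else x (i * d + (k - m)))"
proof -
  have "cdot (\<gamma> k) (\<Sum>l<d. x (i * d + l) *s G (m + l)) = (\<Sum>l<d. if m + l = k then x (i * d + l) else 0)"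
    unfolding cdot_simps using dual_G assms(2) by (intro sum.cong) auto
  also have "\<dots> = (\<Sum>l<d. if k \<ge> m \<and> l = k - m then x (i * d + l) else 0)"
    by (intro sum.cong) auto
  also have "\<dots> = (if k < m then 0 else x (i * d + (k - m)))"
    using assms(2) by auto
  finally show ?thesis
    using assms dual_G [of k i] by (auto simp: graph_frame_def cdot_add)
qed

lemma cdot_sum_graph_frame:
  assumes "k < m"
  shows "cdot (\<gamma> k) (\<Sum>i<m. a i *s graph_frame x i) = a k"
proof -
  have "cdot (\<gamma> k) (\<Sum>i<m. a i *s graph_frame x i) = (\<Sum>i<m. if i = k then a i else 0)"
    unfolding cdot_simps using cdot_graph_frame [of _ k x] assms by (intro sum.cong) auto
  then show ?thesis using assms by simp
qed

lemma graph_frame_in_quotient_frames: "graph_frame x \<in> quotient_frames V R m"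
proof -
  have "a i = 0" if "(\<Sum>i<m. a i *s graph_frame x i) \<in> R" "i < m" for a i
    using cdot_sum_graph_frame [OF that(2), of a x] dual_R [OF _ that(1), of i] that(2) by simp
  moreover have "graph_frame x i \<in> V" if "i < m" for i
    using that G by (auto simp: graph_frame_def intro!: vec.subspace_add [OF V] vec.subspace_sum [OF V] vec.subspace_scale [OF V])
  ultimately show ?thesis
    by (auto simp: quotient_frames_def graph_frame_def)
qed

lemma frame_span_graph_frame_in_chart_domain: "frame_span R m (graph_frame x) \<in> chart_domain"
proof -
  have "det (transition m \<gamma> G (graph_frame x)) \<noteq> 0"
    using det_transition_nonzero_iff [of m \<gamma> G "graph_frame x"] dual_G cdot_sum_graph_frame by simp
  then show ?thesis
    using frame_span_in_chart_domain_iff [OF graph_frame_in_quotient_frames] by blast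
qed

lemma chart_graph_frame:
  assumes "x \<in> {..<m * d} \<rightarrow>\<^sub>E UNIV"
  shows "chart (frame_span R m (graph_frame x)) = x"
proof
  fix j
  show "chart (frame_span R m (graph_frame x)) j = x j"
  proof (cases "j < m * d")
    case True
    note jb = index_bounds [OF True]
    have "graph_frame x (j div d) \<in> \<Union>(frame_span R m (graph_frame x))"
      unfolding Union_frame_span using jb by (intro frame_in_frame_sum R)
    then have "chart (frame_span R m (graph_frame x)) j = cdot (\<gamma> (m + j mod d)) (graph_frame x (j div d))"
      using frame_span_graph_frame_in_chart_domain True jb
      by (intro chart_eq) (simp_all add: cdot_graph_frame)
    then show ?thesis using jb by (simp add: cdot_graph_frame)
  next
    case False
    then show ?thesis using assms by (simp add: chart_def PiE_def extensional_def)
  qed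
qed

text \<open>A point of K over G_i agrees modulo R with the i-th vector of the graph frame, by its
  expansion in \<open>G\<close>. So the graph frame lies in K, and equal dimensions give
  equality.\<close>

lemma graph_frame_chart:
  assumes P: "P \<in> chart_domain"
  shows "frame_span R m (graph_frame (chart P)) = P"
proof -
  obtain F where F: "F \<in> quotient_frames V R m" "P = frame_span R m F"
    using P mem_grassmannian_iff [OF V R RV, of P m] by (auto simp: chart_domain_def)
  let ?K = "frame_sum R m F" and ?\<sigma> = "graph_frame (chart P)"
  have K: "vec.subspace ?K" "?K \<subseteq> V"
    using subspace_frame_sum [OF R] frame_sum_subset [OF V RV quotient_framesD(1) [OF F(1)]] by auto
  have det: "det (transition m \<gamma> G F) \<noteq> 0"
    using frame_span_in_chart_domain_iff [OF F(1)] P F(2) by simp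
  have "?\<sigma> i \<in> ?K" if i: "i < m" for i
  proof -
    obtain x where xK: "x \<in> ?K" and xk: "\<And>k. k < m \<Longrightarrow> cdot (\<gamma> k) x = (if k = i then 1 else 0)"
      using point_over_dual_basis [OF det i] by metis
    have chart_x: "chart P (i * d + l) = cdot (\<gamma> (m + l)) x" if l: "l < d" for l
    proof -
      have "chart P (i * d + l) = cdot (\<gamma> (m + (i * d + l) mod d)) x"
        using l xK xk index_less [OF i l] by (intro chart_eq [OF P]) (simp_all add: F(2) Union_frame_span)
      then show ?thesis using l by simp
    qed
    have "(\<Sum>k<m. cdot (\<gamma> k) x *s G k) = (\<Sum>k<m. if k = i then G k else 0)"
      using xk by (intro sum.cong) auto
    then have "(\<Sum>k<m + d. cdot (\<gamma> k) x *s G k) = ?\<sigma> i"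
      using i chart_x by (simp add: sum_lessThan_add graph_frame_def)
    then have "x - ?\<sigma> i \<in> ?K"
      using expansion [of x] xK K(2) subset_frame_sum [of R m F] by auto
    then have "x - (x - ?\<sigma> i) \<in> ?K"
      by (rule vec.subspace_diff [OF K(1) xK])
    then show ?thesis by simp
  qed
  then have "frame_sum R m ?\<sigma> \<subseteq> ?K"
    by (intro frame_sum_subset K subset_frame_sum)
  then have "frame_sum R m ?\<sigma> = ?K"
    using frame_span_eq_quotient_image(2) [OF V R RV F(1)]
      frame_span_eq_quotient_image(2) [OF V R RV graph_frame_in_quotient_frames, of "chart P"]
    by (intro vec.subspace_dim_equal subspace_frame_sum R K) auto
  then show ?thesis
    using frame_span_eq_quotient_image(1) [OF V R RV F(1)] F(2)
      frame_span_eq_quotient_image(1) [OF V R RV graph_frame_in_quotient_frames, of "chart P"] by simp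
qed

lemma chart_image: "chart ` chart_domain = {..<m * d} \<rightarrow>\<^sub>E UNIV"
proof
  show "chart ` chart_domain \<subseteq> {..<m * d} \<rightarrow>\<^sub>E UNIV"
    unfolding chart_def by (intro image_subsetI, subst restrict_PiE_iff) (intro ballI UNIV_I)
  show "{..<m * d} \<rightarrow>\<^sub>E UNIV \<subseteq> chart ` chart_domain"
    using chart_graph_frame frame_span_graph_frame_in_chart_domain by (metis imageI subsetI)
qed

section \<open>Continuity and holomorphy of the chart and of its inverse\<close>

lemma tendsto_solution:
  assumes F: "F \<in> {..<m} \<rightarrow>\<^sub>E V" and det: "det (transition m \<gamma> G F) \<noteq> 0"
  shows "((\<lambda>F. cdot \<eta> (solution F i)) \<longlongrightarrow> cdot \<eta> (solution F i)) (atin (tuple_topology V m) F)"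
proof -
  have "((\<lambda>F. (\<chi> p q. if q = k then G i $ p else transition m \<gamma> G F $ p $ q) $ p $ q) \<longlongrightarrow>
      (\<chi> p q. if q = k then G i $ p else transition m \<gamma> G F $ p $ q) $ p $ q)
      (atin (tuple_topology V m) F)" for k p q
    using tendsto_transition [OF F] by (cases "q = k") simp_all
  then show ?thesis
    unfolding cdot_def solution_def vec_lambda_beta
    by (intro tendsto_intros tendsto_det tendsto_transition F det)
qed

lemma frames_over_chart_domain:
  "{F \<in> quotient_frames V R m. frame_span R m F \<in> chart_domain} =
     {F \<in> quotient_frames V R m. det (transition m \<gamma> G F) \<noteq> 0}"
  using frame_span_in_chart_domain_iff by blast

lemma openin_chart_domain: "openin (grassmannian_topology V R m) chart_domain"
proof -
  have "continuous_map (tuple_topology V m) euclidean (\<lambda>F. det (transition m \<gamma> G F))"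
    unfolding continuous_map_atin by (auto intro!: tendsto_det tendsto_transition)
  then have "openin (tuple_topology V m)
      {F \<in> topspace (tuple_topology V m). det (transition m \<gamma> G F) \<in> - {0}}"
    by (rule openin_continuous_map_preimage) (simp flip: open_openin add: open_Compl)
  then have "openin (tuple_topology V m)
      (quotient_frames V R m \<inter> {F \<in> topspace (tuple_topology V m). det (transition m \<gamma> G F) \<in> - {0}})"
    by (intro openin_Int openin_quotient_frames R)
  also have "quotient_frames V R m \<inter> {F \<in> topspace (tuple_topology V m). det (transition m \<gamma> G F) \<in> - {0}} =
      {F \<in> quotient_frames V R m. frame_span R m F \<in> chart_domain}"
    unfolding frames_over_chart_domain using quotient_frames_subset_topspace by blast
  finally show ?thesis
    by (auto simp: openin_grassmannian_topology openin_frame_topology [OF R] chart_domain_def)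
qed

text \<open>Continuity is tested on frames, where the chart is given by the quotients of
  determinants in \<open>chart_frame_span\<close>.\<close>

lemma continuous_chart:
  "continuous_map (subtopology (grassmannian_topology V R m) chart_domain)
     (product_topology (\<lambda>_. euclidean) {..<m * d}) chart"
  unfolding continuous_map_componentwise
proof (intro conjI ballI)
  fix j assume "j \<in> {..<m * d}"
  then have j: "j < m * d" by simp
  let ?W = "{F \<in> quotient_frames V R m. frame_span R m F \<in> chart_domain}"
  have sub: "subtopology (frame_topology V R m) ?W = subtopology (tuple_topology V m) ?W"
    by (auto simp: frame_topology_def subtopology_subtopology intro!: arg_cong2 [where f = subtopology])
  have top: "topspace (subtopology (tuple_topology V m) ?W) = ?W"
    unfolding topspace_subtopology using quotient_frames_subset_topspace by blast
  have "continuous_map (subtopology (tuple_topology V m) ?W) euclidean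
      (\<lambda>F. - cdot (\<gamma> (m + j mod d)) (solution F (j div d)))"
    unfolding continuous_map_atin top limitin_canonical_iff
  proof
    fix F assume F: "F \<in> ?W"
    have "((\<lambda>F. - cdot (\<gamma> (m + j mod d)) (solution F (j div d))) \<longlongrightarrow>
       - cdot (\<gamma> (m + j mod d)) (solution F (j div d))) (atin (tuple_topology V m) F)"
      using F unfolding frames_over_chart_domain
      by (intro tendsto_minus tendsto_solution) (auto dest: quotient_framesD(3))
    \<comment> \<open>The limit exists among all tuples and passes to the frames over the
      domain.\<close>
    moreover have "atin (subtopology (tuple_topology V m) ?W) F \<le> atin (tuple_topology V m) F"
      unfolding atin_subtopology_within [OF F] unfolding atin_within_def by (intro inf_mono) auto
    ultimately show "((\<lambda>F. - cdot (\<gamma> (m + j mod d)) (solution F (j div d))) \<longlongrightarrow>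
       - cdot (\<gamma> (m + j mod d)) (solution F (j div d))) (atin (subtopology (tuple_topology V m) ?W) F)"
      by (rule tendsto_mono [rotated])
  qed
  then have "continuous_map (subtopology (frame_topology V R m) ?W) euclidean
      ((\<lambda>P. chart P j) \<circ> frame_span R m)"
    unfolding sub
  proof (rule continuous_map_eq)
    fix F assume "F \<in> topspace (subtopology (tuple_topology V m) ?W)"
    then have "F \<in> ?W" unfolding top .
    then show "- cdot (\<gamma> (m + j mod d)) (solution F (j div d)) = ((\<lambda>P. chart P j) \<circ> frame_span R m) F"
      unfolding frames_over_chart_domain using chart_frame_span j by simp
  qed
  then show "continuous_map (subtopology (grassmannian_topology V R m) chart_domain) euclidean (\<lambda>P. chart P j)"
    by (rule continuous_map_from_grassmannian [OF V R RV openin_chart_domain])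
qed (simp add: chart_def image_subset_iff)

lemma continuous_graph_frame:
  "continuous_map (product_topology (\<lambda>_. euclidean) {..<m * d}) (frame_topology V R m) graph_frame"
  unfolding frame_topology_def
proof (subst continuous_map_in_subtopology, intro conjI)
  let ?E = "product_topology (\<lambda>_. euclidean) {..<m * d} :: (nat \<Rightarrow> complex) topology"
  show "graph_frame \<in> topspace ?E \<rightarrow> quotient_frames V R m"
    using graph_frame_in_quotient_frames by blast
  show "continuous_map ?E (tuple_topology V m) graph_frame"
    unfolding continuous_map_componentwise
  proof (intro conjI ballI)
    fix i assume "i \<in> {..<m}"
    then have i: "i < m" by simp
    have idx: "i * d + l \<in> {..<m * d}" if "l < d" for l
      using index_less [OF i that] by simp
    have "((\<lambda>x. G i + (\<Sum>l<d. x (i * d + l) *s G (m + l))) \<longlongrightarrow>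
        G i + (\<Sum>l<d. x0 (i * d + l) *s G (m + l))) (atin ?E x0)" if x0: "x0 \<in> topspace ?E" for x0
    proof (rule vec_tendstoI)
      fix p
      have "((\<lambda>x. x (i * d + l)) \<longlongrightarrow> x0 (i * d + l)) (atin ?E x0)" if "l < d" for l
        using continuous_map_product_projection [OF idx [OF that], of "\<lambda>_. euclidean :: complex topology"] x0
        by (auto simp: continuous_map_atin)
      then show "((\<lambda>x. (G i + (\<Sum>l<d. x (i * d + l) *s G (m + l))) $ p) \<longlongrightarrow>
          (G i + (\<Sum>l<d. x0 (i * d + l) *s G (m + l))) $ p) (atin ?E x0)"
        by (simp, intro tendsto_intros) auto
    qed
    then have "continuous_map ?E euclidean (\<lambda>x. graph_frame x i)"
      using i by (simp add: continuous_map_atin graph_frame_def)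
    moreover have "graph_frame x i \<in> V" for x
      using quotient_framesD(1) [OF graph_frame_in_quotient_frames i] .
    ultimately show "continuous_map ?E (top_of_set V) (\<lambda>x. graph_frame x i)"
      by (auto simp: continuous_map_in_subtopology)
  qed (auto simp: graph_frame_def)
qed

text \<open>The inverse goes through frames: \<open>graph_frame\<close> followed by the projection
  \<open>frame_span R m\<close>.\<close>

lemma homeomorphic_chart:
  "homeomorphic_map (subtopology (grassmannian_topology V R m) chart_domain)
     (product_topology (\<lambda>_. euclidean) {..<m * d}) chart"
proof -
  let ?E = "product_topology (\<lambda>_. euclidean) {..<m * d} :: (nat \<Rightarrow> complex) topology"
  have "continuous_map ?E (grassmannian_topology V R m) (frame_span R m \<circ> graph_frame)"
    by (rule continuous_map_compose [OF continuous_graph_frame continuous_map_frame_span [OF V R RV]])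
  then have "continuous_map ?E (subtopology (grassmannian_topology V R m) chart_domain)
      (frame_span R m \<circ> graph_frame)"
    using frame_span_graph_frame_in_chart_domain by (auto simp: continuous_map_in_subtopology)
  then have "homeomorphic_maps (subtopology (grassmannian_topology V R m) chart_domain) ?E chart
      (frame_span R m \<circ> graph_frame)"
    using continuous_chart graph_frame_chart chart_graph_frame
    by (auto simp: homeomorphic_maps_def)
  then show ?thesis by (auto simp: homeomorphic_map_maps)
qed

text \<open>Along a line of tuples the numerators and the denominator in Cramer's rule are
  polynomials in the parameter, and the denominator is nonzero at 0.\<close>

lemma field_differentiable_chart:
  assumes F: "F \<in> quotient_frames V R m" and dom: "frame_span R m F \<in> chart_domain"
    and H: "H \<in> {..<m} \<rightarrow>\<^sub>E V" and j: "j < m * d"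
  shows "(\<lambda>t. chart (frame_span R m (\<lambda>i\<in>{..<m}. F i + t *s H i)) j) field_differentiable at 0"
proof -
  define \<gamma>' where "\<gamma>' t = (\<lambda>i\<in>{..<m}. F i + t *s H i)" for t
  define B :: "complex^'n^'n" where "B = (\<chi> p q. \<Sum>i<m. \<gamma> i $ q * H i $ p)"
  obtain p where p: "\<And>t. det (transition m \<gamma> G (\<gamma>' t)) = poly p t"
    using det_affine_poly [of "transition m \<gamma> G F" B]
    unfolding \<gamma>'_def transition_affine B_def by auto
  \<comment> \<open>Replacing column \<open>k\<close> by a constant vector keeps all entries affine
    in t, with slope 0 in that column.\<close>
  have "\<exists>n. \<forall>t. det (\<chi> p q. if q = k then G (j div d) $ p else transition m \<gamma> G (\<gamma>' t) $ p $ q) = poly n t" for k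
  proof -
    obtain n where n: "\<And>t. det (\<chi> p q. (\<chi> p q. if q = k then G (j div d) $ p else transition m \<gamma> G F $ p $ q) $ p $ q +
        t * (\<chi> p q. if q = k then 0 else B $ p $ q) $ p $ q) = poly n t"
      using det_affine_poly by blast
    have eq: "(\<chi> p q. if q = k then G (j div d) $ p else transition m \<gamma> G (\<gamma>' t) $ p $ q) =
       (\<chi> p q. (\<chi> p q. if q = k then G (j div d) $ p else transition m \<gamma> G F $ p $ q) $ p $ q +
        t * (\<chi> p q. if q = k then 0 else B $ p $ q) $ p $ q)" for t
      unfolding \<gamma>'_def transition_affine by (auto simp: vec_eq_iff B_def)
    show ?thesis by (intro exI [of _ n] allI) (simp only: eq n)
  qed
  then obtain n where n: "\<And>k t. det (\<chi> p q. if q = k then G (j div d) $ p else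
      transition m \<gamma> G (\<gamma>' t) $ p $ q) = poly (n k) t"
    by metis
  let ?g = "\<lambda>t. - (\<Sum>k\<in>UNIV. \<gamma> (m + j mod d) $ k * (poly (n k) t / poly p t))"
  have "\<gamma>' 0 = F"
    using quotient_framesD(3) [OF F] by (auto simp: \<gamma>'_def fun_eq_iff PiE_def extensional_def)
  then have p0: "poly p 0 \<noteq> 0"
    using p [of 0] frame_span_in_chart_domain_iff [OF F] dom by simp
  then have "p \<noteq> 0" by auto
  \<comment> \<open>The formula for the chart holds off finitely many parameters, in particular on a
    ball around 0.\<close>
  let ?S = "- ({t. \<gamma>' t \<notin> quotient_frames V R m} \<union> {t. poly p t = 0})"
  have "finite {t. \<gamma>' t \<notin> quotient_frames V R m}"
    unfolding \<gamma>'_def using H by (intro finite_line_not_quotient_frames [OF R V F]) auto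
  then have "open ?S"
    using poly_roots_finite [OF \<open>p \<noteq> 0\<close>] by (intro open_Compl finite_imp_closed) simp
  moreover have "0 \<in> ?S" using \<open>\<gamma>' 0 = F\<close> F p0 by simp
  ultimately obtain e where e: "e > 0" "ball 0 e \<subseteq> ?S"
    using open_contains_ball by blast
  have eq: "?g t = chart (frame_span R m (\<gamma>' t)) j" if "t \<in> ?S" for t
    using that chart_frame_span [of "\<gamma>' t" j] j by (simp add: cdot_def solution_def n p)
  have "(\<lambda>t. poly q t) field_differentiable at x" for q and x :: complex
    using poly_DERIV field_differentiable_def by blast
  then have "?g field_differentiable at 0"
    by (intro derivative_intros p0)
  then have "(\<lambda>t. chart (frame_span R m (\<gamma>' t)) j) field_differentiable at 0"
    by (rule field_differentiable_transform_within [OF e(1), rotated -1])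
      (use e eq in \<open>auto simp: dist_commute subset_iff\<close>)
  then show ?thesis by (simp add: \<gamma>'_def)
qed

lemma field_differentiable_graph_frame:
  assumes i: "i < m"
  shows "(\<lambda>t. graph_frame (\<lambda>l\<in>{..<m * d}. x l + t * y l) i $ p) field_differentiable at 0"
proof -
  have "graph_frame (\<lambda>l\<in>{..<m * d}. x l + t * y l) i $ p =
      G i $ p + (\<Sum>l<d. (x (i * d + l) + t * y (i * d + l)) * G (m + l) $ p)" for t
    using i index_less [OF i] by (simp add: graph_frame_def distrib_right)
  then show ?thesis
    by (simp only:) (intro derivative_intros)
qed

lemma grassmannian_chart_chart: "grassmannian_chart V R m (m * d) chart_domain chart graph_frame"
proof -
  let ?E = "product_topology (\<lambda>_. euclidean) {..<m * d} :: (nat \<Rightarrow> complex) topology"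
  have top: "chart ` chart_domain = topspace ?E"
    by (simp add: chart_image)
  show ?thesis
    unfolding grassmannian_chart_def Let_def top subtopology_topspace
    using openin_chart_domain homeomorphic_chart field_differentiable_chart
      continuous_graph_frame graph_frame_chart field_differentiable_graph_frame
    by blast
qed

end

text \<open>Every point is the centre of a chart: complete one of its frames to a frame of V. The
  transition matrix is then the identity, so the point lies in the domain.\<close>

lemma grassmannian_has_dimI:
  fixes V R :: "(complex^'n::finite) set"
  assumes V: "vec.subspace V" and R: "vec.subspace R" and RV: "R \<subseteq> V"
    and dim: "vec.dim V = vec.dim R + m + d" and nonempty: "grassmannian V R m \<noteq> {}"
  shows "grassmannian_has_dim V R m (m * d)"
  unfolding grassmannian_has_dim_def
proof (intro conjI nonempty ballI)
  fix P assume P: "P \<in> grassmannian V R m"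
  obtain F where F: "F \<in> quotient_frames V R m" "P = frame_span R m F"
    using P mem_grassmannian_iff [OF V R RV, of P m] by blast
  obtain G where G: "G \<in> quotient_frames V R (m + d)" "frame_sum R (m + d) G = V"
    "\<And>i. i < m \<Longrightarrow> G i = F i"
    using quotient_frame_extend [OF V R RV F(1) dim] by blast
  obtain \<gamma> where \<gamma>: "\<And>i x. i < m + d \<Longrightarrow> x \<in> R \<Longrightarrow> cdot (\<gamma> i) x = 0"
    "\<And>i j. i < m + d \<Longrightarrow> j < m + d \<Longrightarrow> cdot (\<gamma> i) (G j) = (if j = i then 1 else 0)"
    using dual_functionals_exist [OF R G(1)] by metis
  \<comment> \<open>\<open>transition m\<close> reads only the first m vectors, where
    \<open>G\<close> and \<open>F\<close> agree.\<close>
  have tr: "transition m \<gamma> G F = transition m \<gamma> G G"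
    using G(3) by (simp add: transition_def)
  interpret dual_frame V R m d G \<gamma>
    by unfold_locales (use V R RV G(2) quotient_framesD(1) [OF G(1)] \<gamma> in auto)
  have "P \<in> chart_domain"
    using frame_span_in_chart_domain_iff [OF F(1)] F(2) by (simp add: tr det_transition_self)
  then show "\<exists>U \<phi> \<sigma>. P \<in> U \<and> grassmannian_chart V R m (m * d) U \<phi> \<sigma>"
    using grassmannian_chart_chart by blast
qed

section \<open>Parametrisation of the equivalence classes and its consequences\<close>

theorem theoremB:
  fixes \<Lambda> :: "'n::finite \<Rightarrow> complex^'k \<Rightarrow> complex" and I :: "'n set"
  assumes "weight_configuration \<Lambda>"
    and "uniform_maximal_rank UNIV CARD('k) \<Lambda>"
    and "singular_support \<Lambda> I"
  shows
    "(let V = coord_space (- I);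
          R = resonance_space \<Lambda> I;
          \<delta> = defect \<Lambda> I;
          d = residual_dim \<Lambda> I;
          A = same_envelope_configs \<Lambda> I;
          E = equivalence_on_configs \<Lambda> I
      in
        (\<exists>\<Phi> D. bij_betw \<Phi> (A // E) D \<and>
           (\<forall>\<beta>\<in>A. \<Phi> (E `` {\<beta>}) = quotient_image R (relation_space (- I) \<beta>)) \<and>
           gdelta_in (grassmannian_topology V R \<delta>) D \<and>
           grassmannian_topology V R \<delta> closure_of D = grassmannian V R \<delta>) \<and>
        grassmannian_has_dim V R \<delta> (\<delta> * d) \<and>
        ((\<forall>\<beta>\<in>A. linearly_equivalent (- I) \<beta> (residual_weight \<Lambda> I)) \<longleftrightarrow> \<delta> = 0) \<and>
        (\<delta> = 0 \<longleftrightarrow> envelope_dim \<Lambda> I = CARD('n) - CARD('k)) \<and>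
        (\<delta> > 0 \<longrightarrow>
          (\<exists>B\<subseteq>A. uncountable B \<and>
             pairwise (\<lambda>\<beta> \<gamma>. \<not> linearly_equivalent (- I) \<beta> \<gamma>) B)))"
proof -
  interpret uniform_configuration \<Lambda> I
    using assms by unfold_locales
  let ?V = "coord_space (- I)" and ?R = "resonance_space \<Lambda> I" and ?\<delta> = "defect \<Lambda> I"
    and ?d = "residual_dim \<Lambda> I" and ?A = "same_envelope_configs \<Lambda> I"
    and ?E = "equivalence_on_configs \<Lambda> I" and ?\<mu> = "residual_weight \<Lambda> I"
  let ?rel = "relation_space (- I) :: ('n \<Rightarrow> complex^'k \<Rightarrow> complex) \<Rightarrow> _"
  let ?T = "transverse_subspaces ?V ?R ?\<delta> avoided"
  note V = subspace_coord_space [of "- I"] and R = subspace_resonance_space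
  note \<mu> = residual_weight_in_same_envelope_configs
  have rel_image: "?rel ` ?A = ?T"
  proof
    show "?rel ` ?A \<subseteq> ?T"
      by (rule image_subsetI)
        (simp add: mem_same_envelope_configs_iff transverse_subspaces_def subspace_relation_space
          relation_space_subset)
    show "?T \<subseteq> ?rel ` ?A"
    proof
      fix K assume K: "K \<in> ?T"
      have "vec.dim K + ?d = card (- I)"
        using K card_compl_support dim_resonance_space_plus_defect by (simp add: transverse_subspaces_def)
      moreover have "?d \<le> CARD('k)" using residual_dim by linarith
      ultimately obtain \<beta> :: "'n \<Rightarrow> complex^'k \<Rightarrow> complex" where \<beta>: "?rel \<beta> = K"
        using configuration_with_relation_space_exists [of K "- I" ?d] K
        by (auto simp: transverse_subspaces_def)
      then have "\<beta> \<in> ?A"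
        using K by (simp add: mem_same_envelope_configs_iff transverse_subspaces_def)
      then show "K \<in> ?rel ` ?A" using \<beta> by blast
    qed
  qed
  have RV: "?R \<subseteq> ?V"
    using \<mu> relation_space_subset by (auto simp: mem_same_envelope_configs_iff)
  have \<mu>T: "?rel ?\<mu> \<in> ?T" using \<mu> rel_image by blast
  note T_facts = V R RV countable_avoided avoided_subspace(1) \<mu>T
  have dimV: "vec.dim ?V = vec.dim ?R + ?\<delta> + ?d"
    using card_compl_support dim_resonance_space_plus_defect by (simp add: dim_coord_space)
  have equiv: "equiv ?A ?E"
    by (intro equivI refl_onI symI transI)
      (auto simp: equivalence_on_configs_def linearly_equivalent_iff)
  have inj_image: "quotient_image ?R (?rel \<beta>) = quotient_image ?R (?rel \<gamma>) \<longleftrightarrow> ?rel \<beta> = ?rel \<gamma>"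
    if "\<beta> \<in> ?A" "\<gamma> \<in> ?A" for \<beta> \<gamma>
    using that inj_on_quotient_image [OF V R RV] subspace_relation_space
    by (auto simp: inj_on_def mem_same_envelope_configs_iff)
  \<comment> \<open>Equivalent configurations have the same relation space, so the value does not
    depend on the representative that \<open>SOME\<close> picks.\<close>
  define \<Phi> where "\<Phi> X = quotient_image ?R (?rel (SOME \<beta>. \<beta> \<in> X))" for X
  have \<Phi>: "\<Phi> (?E `` {\<beta>}) = quotient_image ?R (?rel \<beta>)" if "\<beta> \<in> ?A" for \<beta>
  proof -
    have "\<beta> \<in> ?E `` {\<beta>}" by (rule equiv_class_self [OF equiv that])
    then have "(SOME \<gamma>. \<gamma> \<in> ?E `` {\<beta>}) \<in> ?E `` {\<beta>}"
      by (rule someI [where P = "\<lambda>\<gamma>. \<gamma> \<in> ?E `` {\<beta>}"])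
    moreover have "?rel \<gamma> = ?rel \<beta>" if "\<gamma> \<in> ?E `` {\<beta>}" for \<gamma>
      using that by (simp add: equivalence_on_configs_def linearly_equivalent_iff)
    ultimately have "?rel (SOME \<gamma>. \<gamma> \<in> ?E `` {\<beta>}) = ?rel \<beta>" by blast
    then show ?thesis by (simp only: \<Phi>_def)
  qed
  have "bij_betw \<Phi> (?A // ?E) (quotient_image ?R ` ?T)"
    unfolding bij_betw_def
  proof
    show "inj_on \<Phi> (?A // ?E)"
    proof (rule inj_onI)
      fix X Y assume "X \<in> ?A // ?E" "Y \<in> ?A // ?E" and eq: "\<Phi> X = \<Phi> Y"
      then obtain \<beta> \<gamma> where \<beta>\<gamma>: "\<beta> \<in> ?A" "X = ?E `` {\<beta>}" "\<gamma> \<in> ?A" "Y = ?E `` {\<gamma>}"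
        by (auto elim!: quotientE)
      then have "?rel \<beta> = ?rel \<gamma>"
        using eq \<Phi> inj_image by simp
      then have "(\<beta>, \<gamma>) \<in> ?E"
        using \<beta>\<gamma> by (simp add: equivalence_on_configs_def linearly_equivalent_iff)
      then show "X = Y" using equiv_class_eq [OF equiv] \<beta>\<gamma> by blast
    qed
    have "\<Phi> ` (?A // ?E) = (\<lambda>\<beta>. \<Phi> (?E `` {\<beta>})) ` ?A"
      by (auto simp: quotient_def)
    also have "\<dots> = quotient_image ?R ` ?rel ` ?A"
      using \<Phi> by (simp add: image_image)
    finally show "\<Phi> ` (?A // ?E) = quotient_image ?R ` ?T"
      by (simp add: rel_image)
  qed
  then have param: "\<exists>\<Phi> D. bij_betw \<Phi> (?A // ?E) D \<and>
      (\<forall>\<beta>\<in>?A. \<Phi> (?E `` {\<beta>}) = quotient_image ?R (?rel \<beta>)) \<and>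
      gdelta_in (grassmannian_topology ?V ?R ?\<delta>) D \<and>
      grassmannian_topology ?V ?R ?\<delta> closure_of D = grassmannian ?V ?R ?\<delta>"
    using \<Phi> gdelta_transverse [OF T_facts] dense_transverse [OF T_facts] by blast
  have "quotient_image ?R (?rel ?\<mu>) \<in> grassmannian ?V ?R ?\<delta>"
    using \<mu>T by (auto simp: transverse_subspaces_def grassmannian_def)
  then have has_dim: "grassmannian_has_dim ?V ?R ?\<delta> (?\<delta> * ?d)"
    by (intro grassmannian_has_dimI V R RV dimV) auto
  have many: "\<exists>B\<subseteq>?A. uncountable B \<and> pairwise (\<lambda>\<beta> \<gamma>. \<not> linearly_equivalent (- I) \<beta> \<gamma>) B"
    if "?\<delta> > 0"
  proof -
    \<comment> \<open>For a singular support d_I > 0, so the relation space is a proper subspace of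
      \<complex>^J and a direction outside it exists.\<close>
    have "?rel ?\<mu> \<subseteq> ?V" "vec.dim (?rel ?\<mu>) < vec.dim ?V"
      using \<mu>T dimV residual_dim card_I by (auto simp: transverse_subspaces_def)
    then obtain v where "v \<in> ?V" "v \<notin> ?rel ?\<mu>" by (metis less_irrefl subsetI subset_antisym)
    then have "uncountable ?T"
      using uncountable_transverse [OF T_facts that] by blast
    \<comment> \<open>One configuration for each transverse subspace; inequivalence is then
      injectivity.\<close>
    obtain B where B: "B \<subseteq> ?A" "inj_on ?rel B" "?rel ` B = ?T"
      using subset_image_inj [of ?T ?rel ?A] rel_image by auto
    have "uncountable B" using B(3) \<open>uncountable ?T\<close> by (metis countable_image)
    moreover have "pairwise (\<lambda>\<beta> \<gamma>. \<not> linearly_equivalent (- I) \<beta> \<gamma>) B"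
      using B(2) by (auto simp: pairwise_def linearly_equivalent_iff inj_on_def)
    ultimately show ?thesis using B(1) by blast
  qed
  have unique: "(\<forall>\<beta>\<in>?A. linearly_equivalent (- I) \<beta> ?\<mu>) \<longleftrightarrow> ?\<delta> = 0"
  proof
    assume all: "\<forall>\<beta>\<in>?A. linearly_equivalent (- I) \<beta> ?\<mu>"
    show "?\<delta> = 0"
    proof (rule ccontr)
      assume "?\<delta> \<noteq> 0"
      then obtain B where B: "B \<subseteq> ?A" "uncountable B" "pairwise (\<lambda>\<beta> \<gamma>. \<not> linearly_equivalent (- I) \<beta> \<gamma>) B"
        using many by auto
      \<comment> \<open>All members of \<open>B\<close> are equivalent to the residual weights and
        hence to each other, so pairwise inequivalence leaves at most one.\<close>
      then have "\<beta> = \<gamma>" if "\<beta> \<in> B" "\<gamma> \<in> B" for \<beta> \<gamma>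
        using that all by (auto simp: pairwise_def linearly_equivalent_iff subset_iff)
      then have "B \<subseteq> {SOME \<beta>. \<beta> \<in> B}" by (metis someI singletonI subsetI)
      then show False using B(2) countable_subset by blast
    qed
  next
    assume "?\<delta> = 0"
    \<comment> \<open>Each relation space contains R_I and now has the same dimension.\<close>
    then have "?rel \<beta> = ?R" if "\<beta> \<in> ?A" for \<beta>
      using that vec.subspace_dim_equal [OF R subspace_relation_space, of "- I" \<beta>]
      by (simp add: mem_same_envelope_configs_iff)
    then show "\<forall>\<beta>\<in>?A. linearly_equivalent (- I) \<beta> ?\<mu>"
      using \<mu> by (simp add: linearly_equivalent_iff)
  qed
  have "?\<delta> = 0 \<longleftrightarrow> envelope_dim \<Lambda> I = CARD('n) - CARD('k)"
    using dim_resonance_space_plus_defect by (auto simp: envelope_dim_eq)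
  then show ?thesis
    unfolding Let_def using param has_dim unique many by blast
qed

end
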